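(* Let $M$ be an $n$-dimensional smooth manifold, let $E\in\Gamma(T^*M\otimes T^*M)$ be invertible, and let $\rho_a\in\Gamma(TM)$, $a=1,\dots,n$, be involutive vector fields with $[\rho_a,\rho_b]=C^c{}_{ab}\rho_c$ such that the matrix $\rho=(\rho^\mu_a)$ is invertible. Then the generalised Killing equation $$(\mathcal{L}_{\rho_a}E)_{\mu\nu}=E_{\mu\lambda}\rho^\lambda_b(\Omega^+)^b{}_{\nu a}+E_{\lambda\nu}\rho^\lambda_b(\Omega^-)^b{}_{\mu a}$$ has solutions $\Omega^\pm$. Furthermore, if ${}^Q\Omega^-$ defines a flat connection ${}^Q\nabla^-$, then ${}^Q\Omega^+$ given by $$({}^Q\Omega^+)^b{}_{ac}=(\mathsf{E}^{-1})^{bd}\rho^\mu_a\partial_\mu\mathsf{E}_{dc}-\mathsf{E}_{dc}({}^Q\Omega^-)^d{}_{ae}(\mathsf{E}^{-1})^{be}$$ defines a flat connection ${}^Q\nabla^+$.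
   Context: All formulas are in local coordinates $x^\mu$ with the summation convention; Greek and Latin indices both run over $1,\dots,n$. $\rho_a=\rho^\mu_a\partial_\mu$, $C^c{}_{ab}\in C^\infty(M)$, and $\mathcal{L}$ is the Lie derivative. $Q\to M$ is a rank-$n$ vector bundle with local frame $\{e_a\}$, with Lie algebroid structure $[e_a,e_b]_Q=C^c{}_{ab}e_c$ and anchor $\rho(e_a)=\rho_a$ (so $\rho$ is an isomorphism $Q\cong TM$). $\mathsf{E}_{ab}=\rho^\mu_aE_{\mu\nu}\rho^\nu_b$, with inverse matrix $(\mathsf{E}^{-1})^{ab}$. $(\Omega^\pm)^b{}_{\mu a}$ are the coefficients of $TM$-connections $\nabla^\pm$ on $Q$, $\nabla^\pm e_a=(\Omega^\pm)^b{}_a\otimes e_b$. The adjoint connections are the $Q$-connections on $Q$ defined by ${}^Q\nabla^\pm_{q_1}q_2:=\nabla^\pm_{\rho(q_2)}q_1+[q_1,q_2]_Q$, with coefficients ${}^Q\nabla^\pm_{e_b}e_c=({}^Q\Omega^\pm)^a{}_{bc}e_a$, i.e. $({}^Q\Omega^\pm)^a{}_{bc}=\rho^\mu_c(\Omega^\pm)^a{}_{\mu b}+C^a{}_{bc}$; since $\rho$ is invertible, $\Omega^\pm$ and ${}^Q\Omega^\pm$ determine each other. A $Q$-connection $\nabla$ on $Q$ is flat if $\nabla_{q_1}\nabla_{q_2}q_3-\nabla_{q_2}\nabla_{q_1}q_3-\nabla_{[q_1,q_2]_Q}q_3=0$ for all sections. *)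

theory Defs
  imports "HOL-Analysis.Analysis"
begin

(* Smooth maps and manifolds.  The derivatives below are full (two-sided) Frechet
   derivatives, so the sets S are meant to be open. *)

primrec Ck_on :: "nat \<Rightarrow> 'a::real_normed_vector set \<Rightarrow> ('a \<Rightarrow> 'b::real_normed_vector) \<Rightarrow> bool"
where
  "Ck_on 0 S f \<longleftrightarrow> continuous_on S f"
| "Ck_on (Suc k) S f \<longleftrightarrow>
     (\<forall>x\<in>S. f differentiable (at x)) \<and>
     (\<forall>v. Ck_on k S (\<lambda>x. frechet_derivative f (at x) v))"

definition smooth_on :: "'a::real_normed_vector set \<Rightarrow> ('a \<Rightarrow> 'b::real_normed_vector) \<Rightarrow> bool"
  where "smooth_on S f \<longleftrightarrow> (\<forall>k. Ck_on k S f)"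

(* A chart is a pair of its domain and its coordinate map; the values of the coordinate map
   outside the domain are irrelevant. *)

type_synonym ('m, 'n) chart = "'m set \<times> ('m \<Rightarrow> real ^ 'n)"

definition is_chart :: "'m topology \<Rightarrow> ('m, 'n::finite) chart \<Rightarrow> bool"
  where "is_chart X c \<longleftrightarrow>
    openin X (fst c) \<and> open (snd c ` fst c) \<and>
    homeomorphic_map (subtopology X (fst c)) (top_of_set (snd c ` fst c)) (snd c)"

(* The atlas need not be maximal: every smooth atlas is contained in exactly one maximal one,
   and the maximal atlas is itself an admissible A. *)

definition smooth_manifold :: "'m topology \<Rightarrow> ('m, 'n::finite) chart set \<Rightarrow> bool"
  where "smooth_manifold X A \<longleftrightarrow>
    Hausdorff_space X \<and> second_countable X \<and>
    (\<forall>c\<in>A. is_chart X c) \<and> (\<Union>c\<in>A. fst c) = topspace X \<and>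
    (\<forall>c\<in>A. \<forall>c'\<in>A. smooth_on (snd c ` (fst c \<inter> fst c')) (snd c' \<circ> inv_into (fst c) (snd c)))"

definition smooth_in :: "('m, 'n::finite) chart \<Rightarrow> ('m \<Rightarrow> real) \<Rightarrow> bool"
  where "smooth_in c f \<longleftrightarrow> smooth_on (snd c ` fst c) (f \<circ> inv_into (fst c) (snd c))"

definition smooth_function :: "('m, 'n::finite) chart set \<Rightarrow> ('m \<Rightarrow> real) \<Rightarrow> bool"
  where "smooth_function A f \<longleftrightarrow> (\<forall>c\<in>A. smooth_in c f)"

(* The coordinate derivative of f along the mu-th coordinate of c, at a point p of the domain. *)

definition chart_pd :: "('m, 'n::finite) chart \<Rightarrow> 'n \<Rightarrow> ('m \<Rightarrow> real) \<Rightarrow> 'm \<Rightarrow> real"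
  where "chart_pd c \<mu> f p =
    frechet_derivative (f \<circ> inv_into (fst c) (snd c)) (at (snd c p)) (axis \<mu> 1)"

(* jac c c' p mu nu is the derivative of the mu-th coordinate of c' along the nu-th
   coordinate of c. *)

definition jac :: "('m, 'n::finite) chart \<Rightarrow> ('m, 'n) chart \<Rightarrow> 'm \<Rightarrow> 'n \<Rightarrow> 'n \<Rightarrow> real"
  where "jac c c' p \<mu> \<nu> = chart_pd c \<nu> (\<lambda>x. snd c' x $ \<mu>) p"

(* Tensor fields are given by their components in every chart of the atlas, subject to the
   usual transformation laws on overlaps.  Components at points outside the domain of the
   chart, or in charts outside the atlas, carry no meaning. *)

type_synonym ('m, 'n) vector_comps = "('m, 'n) chart \<Rightarrow> 'm \<Rightarrow> real ^ 'n"
type_synonym ('m, 'n) covector_comps = "('m, 'n) chart \<Rightarrow> 'm \<Rightarrow> real ^ 'n"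
type_synonym ('m, 'n) tensor2_comps = "('m, 'n) chart \<Rightarrow> 'm \<Rightarrow> real ^ 'n ^ 'n"

definition vector_field :: "('m, 'n::finite) chart set \<Rightarrow> ('m, 'n) vector_comps \<Rightarrow> bool"
  where "vector_field A v \<longleftrightarrow>
    (\<forall>c\<in>A. \<forall>\<mu>. smooth_in c (\<lambda>p. v c p $ \<mu>)) \<and>
    (\<forall>c\<in>A. \<forall>c'\<in>A. \<forall>p\<in>fst c \<inter> fst c'. \<forall>\<mu>.
       v c' p $ \<mu> = (\<Sum>\<nu>\<in>UNIV. jac c c' p \<mu> \<nu> * v c p $ \<nu>))"

definition one_form :: "('m, 'n::finite) chart set \<Rightarrow> ('m, 'n) covector_comps \<Rightarrow> bool"
  where "one_form A w \<longleftrightarrow>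
    (\<forall>c\<in>A. \<forall>\<mu>. smooth_in c (\<lambda>p. w c p $ \<mu>)) \<and>
    (\<forall>c\<in>A. \<forall>c'\<in>A. \<forall>p\<in>fst c \<inter> fst c'. \<forall>\<mu>.
       w c p $ \<mu> = (\<Sum>\<kappa>\<in>UNIV. w c' p $ \<kappa> * jac c c' p \<kappa> \<mu>))"

definition covariant2 :: "('m, 'n::finite) chart set \<Rightarrow> ('m, 'n) tensor2_comps \<Rightarrow> bool"
  where "covariant2 A E \<longleftrightarrow>
    (\<forall>c\<in>A. \<forall>\<mu> \<nu>. smooth_in c (\<lambda>p. E c p $ \<mu> $ \<nu>)) \<and>
    (\<forall>c\<in>A. \<forall>c'\<in>A. \<forall>p\<in>fst c \<inter> fst c'. \<forall>\<mu> \<nu>.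
       E c p $ \<mu> $ \<nu> =
         (\<Sum>\<kappa>\<in>UNIV. \<Sum>\<tau>\<in>UNIV. E c' p $ \<kappa> $ \<tau> * jac c c' p \<kappa> \<mu> * jac c c' p \<tau> \<nu>))"

(* The operators below are written in the local coordinates of a chart c and are meaningful at
   points of its domain; for tensorial arguments their values do not depend on c. *)

definition vderiv :: "('m, 'n::finite) chart \<Rightarrow> ('m, 'n) vector_comps \<Rightarrow> ('m \<Rightarrow> real) \<Rightarrow> 'm \<Rightarrow> real"
  where "vderiv c v f p = (\<Sum>\<mu>\<in>UNIV. v c p $ \<mu> * chart_pd c \<mu> f p)"

definition lie_bracket ::
    "('m, 'n::finite) chart \<Rightarrow> ('m, 'n) vector_comps \<Rightarrow> ('m, 'n) vector_comps \<Rightarrow> 'm \<Rightarrow> real ^ 'n"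
  where "lie_bracket c v w p =
    (\<chi> \<mu>. vderiv c v (\<lambda>x. w c x $ \<mu>) p - vderiv c w (\<lambda>x. v c x $ \<mu>) p)"

definition lie_derivative ::
    "('m, 'n::finite) chart \<Rightarrow> ('m, 'n) vector_comps \<Rightarrow> ('m, 'n) tensor2_comps \<Rightarrow> 'm \<Rightarrow> real ^ 'n ^ 'n"
  where "lie_derivative c v E p =
    (\<chi> \<mu> \<nu>. vderiv c v (\<lambda>x. E c x $ \<mu> $ \<nu>) p
      + (\<Sum>\<tau>\<in>UNIV. E c p $ \<tau> $ \<nu> * chart_pd c \<mu> (\<lambda>x. v c x $ \<tau>) p)
      + (\<Sum>\<tau>\<in>UNIV. E c p $ \<mu> $ \<tau> * chart_pd c \<nu> (\<lambda>x. v c x $ \<tau>) p))"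

(* As the rho_a form a global frame of TM and the anchor is an isomorphism, the e_a form a
   global frame of Q.  A section of Q is therefore given by its components in that frame. *)

type_synonym ('m, 'n) Q_section = "'m \<Rightarrow> real ^ 'n"

definition smooth_section :: "('m, 'n::finite) chart set \<Rightarrow> ('m, 'n) Q_section \<Rightarrow> bool"
  where "smooth_section A q \<longleftrightarrow> (\<forall>a. smooth_function A (\<lambda>p. q p $ a))"

definition Q_frame :: "'n::finite \<Rightarrow> ('m, 'n) Q_section"
  where "Q_frame a = (\<lambda>p. axis a 1)"

definition anchor :: "('n::finite \<Rightarrow> ('m, 'n) vector_comps) \<Rightarrow> ('m, 'n) Q_section \<Rightarrow> ('m, 'n) vector_comps"
  where "anchor \<rho> q = (\<lambda>c p. \<Sum>a\<in>UNIV. q p $ a *\<^sub>R \<rho> a c p)"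

(* Structure functions are indexed as "C c a b" with the upper index first.  The bracket is
   the extension of [e_a, e_b] = C^c_ab e_c to all sections by the Leibniz rule. *)

definition Q_bracket ::
    "('m, 'n::finite) chart \<Rightarrow> ('n \<Rightarrow> ('m, 'n) vector_comps) \<Rightarrow> ('n \<Rightarrow> 'n \<Rightarrow> 'n \<Rightarrow> 'm \<Rightarrow> real) \<Rightarrow>
     ('m, 'n) Q_section \<Rightarrow> ('m, 'n) Q_section \<Rightarrow> ('m, 'n) Q_section"
  where "Q_bracket c \<rho> C q1 q2 p =
    (\<chi> d. vderiv c (anchor \<rho> q1) (\<lambda>x. q2 x $ d) p - vderiv c (anchor \<rho> q2) (\<lambda>x. q1 x $ d) p
      + (\<Sum>a\<in>UNIV. \<Sum>b\<in>UNIV. C d a b p * q1 p $ a * q2 p $ b))"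

(* A TM-connection on Q is given by its matrix of connection one-forms: the coefficient
   with upper index b, form index mu and lower index a is "Om b a c p $ mu". *)

type_synonym ('m, 'n) TM_conn = "'n \<Rightarrow> 'n \<Rightarrow> ('m, 'n) covector_comps"

definition TM_connection :: "('m, 'n::finite) chart set \<Rightarrow> ('m, 'n) TM_conn \<Rightarrow> bool"
  where "TM_connection A \<Omega> \<longleftrightarrow> (\<forall>b a. one_form A (\<Omega> b a))"

definition TM_nabla ::
    "('m, 'n::finite) chart \<Rightarrow> ('m, 'n) TM_conn \<Rightarrow> ('m, 'n) vector_comps \<Rightarrow>
     ('m, 'n) Q_section \<Rightarrow> ('m, 'n) Q_section"
  where "TM_nabla c \<Omega> v q p =
    (\<chi> b. vderiv c v (\<lambda>x. q x $ b) p
      + (\<Sum>a\<in>UNIV. \<Sum>\<mu>\<in>UNIV. v c p $ \<mu> * \<Omega> b a c p $ \<mu> * q p $ a))"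

definition adjoint_nabla ::
    "('m, 'n::finite) chart \<Rightarrow> ('n \<Rightarrow> ('m, 'n) vector_comps) \<Rightarrow> ('n \<Rightarrow> 'n \<Rightarrow> 'n \<Rightarrow> 'm \<Rightarrow> real) \<Rightarrow>
     ('m, 'n) TM_conn \<Rightarrow> ('m, 'n) Q_section \<Rightarrow> ('m, 'n) Q_section \<Rightarrow> ('m, 'n) Q_section"
  where "adjoint_nabla c \<rho> C \<Omega> q1 q2 p =
    TM_nabla c \<Omega> (anchor \<rho> q2) q1 p + Q_bracket c \<rho> C q1 q2 p"

(* The a-component of the adjoint derivative of e_d along e_b. *)

definition adjoint_coeff ::
    "('m, 'n::finite) chart \<Rightarrow> ('n \<Rightarrow> ('m, 'n) vector_comps) \<Rightarrow> ('n \<Rightarrow> 'n \<Rightarrow> 'n \<Rightarrow> 'm \<Rightarrow> real) \<Rightarrow>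
     ('m, 'n) TM_conn \<Rightarrow> 'n \<Rightarrow> 'n \<Rightarrow> 'n \<Rightarrow> 'm \<Rightarrow> real"
  where "adjoint_coeff c \<rho> C \<Omega> a b d p = adjoint_nabla c \<rho> C \<Omega> (Q_frame b) (Q_frame d) p $ a"

(* D c q1 q2 is the derivative of q2 along q1, computed in the chart c. *)

definition flat_Q_connection ::
    "('m, 'n::finite) chart set \<Rightarrow> ('n \<Rightarrow> ('m, 'n) vector_comps) \<Rightarrow> ('n \<Rightarrow> 'n \<Rightarrow> 'n \<Rightarrow> 'm \<Rightarrow> real) \<Rightarrow>
     (('m, 'n) chart \<Rightarrow> ('m, 'n) Q_section \<Rightarrow> ('m, 'n) Q_section \<Rightarrow> ('m, 'n) Q_section) \<Rightarrow> bool"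
  where "flat_Q_connection A \<rho> C D \<longleftrightarrow>
    (\<forall>q1 q2 q3. smooth_section A q1 \<longrightarrow> smooth_section A q2 \<longrightarrow> smooth_section A q3 \<longrightarrow>
      (\<forall>c\<in>A. \<forall>p\<in>fst c.
        D c q1 (D c q2 q3) p - D c q2 (D c q1 q3) p - D c (Q_bracket c \<rho> C q1 q2) q3 p = 0))"

(* Row index mu, column index a. *)

definition anchor_matrix ::
    "('n::finite \<Rightarrow> ('m, 'n) vector_comps) \<Rightarrow> ('m, 'n) chart \<Rightarrow> 'm \<Rightarrow> real ^ 'n ^ 'n"
  where "anchor_matrix \<rho> c p = (\<chi> \<mu> a. \<rho> a c p $ \<mu>)"

definition frame_comps ::
    "('m, 'n::finite) chart \<Rightarrow> ('m, 'n) tensor2_comps \<Rightarrow> ('n \<Rightarrow> ('m, 'n) vector_comps) \<Rightarrow> 'm \<Rightarrow> real ^ 'n ^ 'n"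
  where "frame_comps c E \<rho> p =
    (\<chi> a b. \<Sum>\<mu>\<in>UNIV. \<Sum>\<nu>\<in>UNIV. \<rho> a c p $ \<mu> * E c p $ \<mu> $ \<nu> * \<rho> b c p $ \<nu>)"

definition generalised_Killing ::
    "('m, 'n::finite) chart set \<Rightarrow> ('m, 'n) tensor2_comps \<Rightarrow> ('n \<Rightarrow> ('m, 'n) vector_comps) \<Rightarrow>
     ('m, 'n) TM_conn \<Rightarrow> ('m, 'n) TM_conn \<Rightarrow> bool"
  where "generalised_Killing A E \<rho> \<Omega>p \<Omega>m \<longleftrightarrow>
    (\<forall>c\<in>A. \<forall>p\<in>fst c. \<forall>a \<mu> \<nu>.
      lie_derivative c (\<rho> a) E p $ \<mu> $ \<nu> =
        (\<Sum>\<tau>\<in>UNIV. \<Sum>b\<in>UNIV. E c p $ \<mu> $ \<tau> * \<rho> b c p $ \<tau> * \<Omega>p b a c p $ \<nu>)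
      + (\<Sum>\<tau>\<in>UNIV. \<Sum>b\<in>UNIV. E c p $ \<tau> $ \<nu> * \<rho> b c p $ \<tau> * \<Omega>m b a c p $ \<mu>))"

end

theory Submission
  imports Defs
begin

text \<open>
  The generalised Killing equation is a duality between the two adjoint connections. Contract it
  for \<open>\<rho>\<^sub>a\<close> with \<open>\<rho>\<^sub>c\<close> in the first slot and \<open>\<rho>\<^sub>d\<close> in the second; because the \<open>\<rho>\<^sub>a\<close> form a frame, this
  loses nothing. The Lie derivative becomes \<open>\<rho>\<^sub>a(E\<^sub>c\<^sub>d)\<close> minus two terms containing the structure
  functions (lemma \<open>frame_lie_derivative\<close>), and these are exactly the terms by which the coefficients
  of an adjoint connection differ from the contraction of \<open>\<Omega>\<close> with the frame. What remains is
  the Leibniz rule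
  \<open>\<rho>(s) E(q,r) = E(D\<^sup>-\<^sub>s q, r) + E(q, D\<^sup>+\<^sub>s r)\<close>
  for sections \<open>s\<close>, \<open>q\<close>, \<open>r\<close> of \<open>Q\<close>, where \<open>D\<^sup>\<plusminus>\<close> are the adjoint connections
  (\<open>Killing_iff_metric_dual\<close>, \<open>metric_dual_Leibniz\<close>).

  All claims follow from this reformulation. As \<open>E\<close> is nondegenerate, the rule can be solved for
  \<open>D\<^sup>+\<close> whatever \<open>D\<^sup>-\<close> is, and the solution is the formula of the theorem. Taking \<open>\<Omega>\<^sup>- = 0\<close>
  gives the existence of solutions. For flatness, apply the rule twice and antisymmetrise: the terms
  mixing \<open>D\<^sup>-\<close> and \<open>D\<^sup>+\<close> cancel, and since the anchor maps the bracket of \<open>Q\<close> to the Lie bracket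
  (\<open>anchor_commutator\<close>), the curvatures satisfy
  \<open>E(R\<^sup>- q, r) + E(q, R\<^sup>+ r) = 0\<close> (\<open>metric_dual_curvature\<close>).
  Nondegeneracy turns \<open>R\<^sup>- = 0\<close> into \<open>R\<^sup>+ = 0\<close>; no curvature is computed in coefficients.

  Two points lie outside this algebra. The commutator of two vector fields is a first-order operator only
  because second partial derivatives commute, which is proved from the mean value theorem. And
  \<open>\<Omega>\<^sup>+\<close> must be a globally defined smooth object: in the frame its coefficients are scalar functions
  that do not depend on the chart (\<open>dual_adjoint_matrix_chart_independent\<close>), and contracting them with
  the dual coframe, the inverse of the anchor matrix, yields one-forms.
\<close>

section \<open>Smooth functions on open sets\<close>

lemma Ck_on_cong:
  assumes "open S" "Ck_on k S f" "\<And>x. x \<in> S \<Longrightarrow> f x = g x"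
  shows "Ck_on k S g"
  using assms(2,3)
proof (induction k arbitrary: f g)
  case 0
  then show ?case by (simp cong: continuous_on_cong)
next
  case (Suc k)
  have d: "g differentiable at x" if "x \<in> S" for x
    using Suc.prems that assms(1) unfolding differentiable_def
    by (metis Ck_on.simps(2) differentiable_def has_derivative_transform_within_open)
  have e: "frechet_derivative f (at x) = frechet_derivative g (at x)" if "x \<in> S" for x
    using Suc.prems that assms(1) by (intro frechet_derivative_transform_within_open[of _ _ S]) auto
  have "Ck_on k S (\<lambda>x. frechet_derivative g (at x) v)" for v
    by (rule Suc.IH[of "\<lambda>x. frechet_derivative f (at x) v"]) (use Suc.prems in \<open>auto simp: e\<close>)
  then show ?case using d by simp
qed

lemma Ck_on_SucD: "Ck_on (Suc k) S f \<Longrightarrow> Ck_on k S f"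
proof (induction k arbitrary: f)
  case 0
  then show ?case
    by (auto intro!: continuous_at_imp_continuous_on differentiable_imp_continuous_within)
next
  case (Suc k)
  then show ?case by (metis Ck_on.simps(2))
qed

lemma Ck_on_const: "Ck_on k S (\<lambda>x. a)"
  by (induction k arbitrary: a) auto

lemma Ck_on_add:
  assumes "open S" "Ck_on k S f" "Ck_on k S g"
  shows "Ck_on k S (\<lambda>x. f x + g x)"
  using assms(2,3)
proof (induction k arbitrary: f g)
  case 0
  then show ?case by (simp add: continuous_on_add)
next
  case (Suc k)
  have D: "((\<lambda>x. f x + g x) has_derivative
      (\<lambda>v. frechet_derivative f (at x) v + frechet_derivative g (at x) v)) (at x)" if "x \<in> S" for x
    using Suc.prems that by (auto intro!: has_derivative_add simp: frechet_derivative_works[symmetric])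
  have "Ck_on k S (\<lambda>x. frechet_derivative (\<lambda>x. f x + g x) (at x) v)" for v
  proof (rule Ck_on_cong[OF assms(1)])
    show "Ck_on k S (\<lambda>x. frechet_derivative f (at x) v + frechet_derivative g (at x) v)"
      using Suc.prems by (intro Suc.IH) simp_all
  qed (simp add: frechet_derivative_at[OF D, symmetric])
  then show ?case using D by (auto simp: differentiable_def)
qed

lemma Ck_on_mult:
  fixes f g :: "'a::real_normed_vector \<Rightarrow> real"
  assumes "open S" "Ck_on k S f" "Ck_on k S g"
  shows "Ck_on k S (\<lambda>x. f x * g x)"
  using assms(2,3)
proof (induction k arbitrary: f g)
  case 0
  then show ?case by (simp add: continuous_on_mult)
next
  case (Suc k)
  have D: "((\<lambda>x. f x * g x) has_derivative
      (\<lambda>v. f x * frechet_derivative g (at x) v + frechet_derivative f (at x) v * g x)) (at x)"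
    if "x \<in> S" for x
    using Suc.prems that by (auto intro!: has_derivative_mult simp: frechet_derivative_works[symmetric])
  have "Ck_on k S (\<lambda>x. frechet_derivative (\<lambda>x. f x * g x) (at x) v)" for v
  proof (rule Ck_on_cong[OF assms(1) Ck_on_add[OF assms(1)]])
    show "Ck_on k S (\<lambda>x. f x * frechet_derivative g (at x) v)"
      "Ck_on k S (\<lambda>x. frechet_derivative f (at x) v * g x)"
      using Suc.prems Suc.prems[THEN Ck_on_SucD] by (auto intro: Suc.IH)
  qed (simp add: frechet_derivative_at[OF D, symmetric])
  then show ?case using D by (auto simp: differentiable_def)
qed

lemma Ck_on_inverse:
  fixes f :: "'a::real_normed_vector \<Rightarrow> real"
  assumes "open S" "Ck_on k S f" "\<And>x. x \<in> S \<Longrightarrow> f x \<noteq> 0"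
  shows "Ck_on k S (\<lambda>x. inverse (f x))"
  using assms(2)
proof (induction k)
  case 0
  then show ?case using assms(3) by (simp add: continuous_on_inverse)
next
  case (Suc k)
  have D: "((\<lambda>x. inverse (f x)) has_derivative
      (\<lambda>v. - (inverse (f x) * frechet_derivative f (at x) v * inverse (f x)))) (at x)"
    if "x \<in> S" for x
    using Suc.prems that assms(3)
    by (auto intro!: has_derivative_inverse simp: frechet_derivative_works[symmetric])
  have i: "Ck_on k S (\<lambda>x. inverse (f x))"
    using Suc.IH Suc.prems Ck_on_SucD by blast
  have "Ck_on k S (\<lambda>x. frechet_derivative (\<lambda>x. inverse (f x)) (at x) v)" for v
  proof (rule Ck_on_cong[OF assms(1)])
    have "Ck_on k S (\<lambda>x. frechet_derivative f (at x) v)"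
      using Suc.prems by simp
    then show "Ck_on k S (\<lambda>x. (-1) * (inverse (f x) * frechet_derivative f (at x) v * inverse (f x)))"
      by (intro Ck_on_mult[OF assms(1)] i Ck_on_const)
  qed (simp add: frechet_derivative_at[OF D, symmetric])
  then show ?case using D by (auto simp: differentiable_def)
qed

lemma smooth_on_cong: "open S \<Longrightarrow> smooth_on S f \<Longrightarrow> (\<And>x. x \<in> S \<Longrightarrow> f x = g x) \<Longrightarrow> smooth_on S g"
  unfolding smooth_on_def using Ck_on_cong by blast

lemma smooth_on_differentiable: "smooth_on S f \<Longrightarrow> x \<in> S \<Longrightarrow> f differentiable at x"
  unfolding smooth_on_def by (metis Ck_on.simps(2))

lemma smooth_on_derivative: "smooth_on S f \<Longrightarrow> smooth_on S (\<lambda>x. frechet_derivative f (at x) v)"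
  unfolding smooth_on_def by (metis Ck_on.simps(2))

lemma smooth_on_continuous: "smooth_on S f \<Longrightarrow> continuous_on S f"
  unfolding smooth_on_def by (metis Ck_on.simps(1))

section \<open>Symmetry of second derivatives\<close>

text \<open>The mean value theorem, applied once in each direction, turns the second difference of \<open>f\<close>
  over a parallelogram into a value of the mixed derivative inside it.\<close>

lemma second_difference_mean_value:
  fixes f :: "'a::real_normed_vector \<Rightarrow> real"
  assumes t: "t > 0" "t * (norm v + norm w) < r"
    and f: "\<And>y. y \<in> ball x r \<Longrightarrow> f differentiable at y"
    and df: "\<And>y. y \<in> ball x r \<Longrightarrow> (\<lambda>z. frechet_derivative f (at z) v) differentiable at y"
  shows "\<exists>y. dist x y \<le> t * (norm v + norm w) \<and>
    f (x + t *\<^sub>R v + t *\<^sub>R w) - f (x + t *\<^sub>R v) - f (x + t *\<^sub>R w) + f x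
      = t\<^sup>2 * frechet_derivative (\<lambda>z. frechet_derivative f (at z) v) (at y) w"
proof -
  define g where "g = (\<lambda>z. frechet_derivative f (at z) v)"
  have near: "dist x (x + a *\<^sub>R v + b *\<^sub>R w) \<le> t * (norm v + norm w)"
    if "0 \<le> a" "a \<le> t" "0 \<le> b" "b \<le> t" for a b
  proof -
    have "dist x (x + a *\<^sub>R v + b *\<^sub>R w) = norm (a *\<^sub>R v + b *\<^sub>R w)"
      by (metis add.assoc add_diff_cancel_left' dist_commute dist_norm)
    also have "\<dots> \<le> a * norm v + b * norm w"
      using that norm_triangle_ineq[of "a *\<^sub>R v" "b *\<^sub>R w"] by simp
    also have "\<dots> \<le> t * norm v + t * norm w"
      using that by (intro add_mono mult_right_mono) auto
    finally show ?thesis by (simp add: algebra_simps)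
  qed
  then have inball: "x + a *\<^sub>R v + b *\<^sub>R w \<in> ball x r"
    if "0 \<le> a" "a \<le> t" "0 \<le> b" "b \<le> t" for a b
    using t that by (meson le_less_trans mem_ball)
  have Df: "((\<lambda>s. f (x + s *\<^sub>R v + b *\<^sub>R w)) has_real_derivative g (x + s *\<^sub>R v + b *\<^sub>R w)) (at s)"
    if "0 \<le> s" "s \<le> t" "0 \<le> b" "b \<le> t" for s b
  proof -
    let ?y = "x + s *\<^sub>R v + b *\<^sub>R w"
    have D: "(f has_derivative frechet_derivative f (at ?y)) (at ?y)"
      using f[OF inball[OF that]] by (simp add: frechet_derivative_works[symmetric])
    have "((\<lambda>s. f (x + s *\<^sub>R v + b *\<^sub>R w)) has_derivative
        (\<lambda>h. frechet_derivative f (at ?y) (h *\<^sub>R v))) (at s)"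
      by (rule has_derivative_compose[where f = "\<lambda>s. x + s *\<^sub>R v + b *\<^sub>R w" and x = s, OF _ D]) (auto intro!: derivative_eq_intros)
    moreover have "(\<lambda>h. frechet_derivative f (at ?y) (h *\<^sub>R v)) = (*) (g ?y)"
      using linear_cmul[OF has_derivative_linear[OF D]] by (auto simp: g_def)
    ultimately show ?thesis by (simp add: has_field_derivative_def)
  qed
  have Dg: "((\<lambda>s. g (x + a *\<^sub>R v + s *\<^sub>R w)) has_real_derivative
      frechet_derivative g (at (x + a *\<^sub>R v + s *\<^sub>R w)) w) (at s)"
    if "0 \<le> a" "a \<le> t" "0 \<le> s" "s \<le> t" for a s
  proof -
    let ?y = "x + a *\<^sub>R v + s *\<^sub>R w"
    have D: "(g has_derivative frechet_derivative g (at ?y)) (at ?y)"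
      using df[OF inball[OF that]] by (simp add: frechet_derivative_works[symmetric] g_def)
    have "((\<lambda>s. g (x + a *\<^sub>R v + s *\<^sub>R w)) has_derivative
        (\<lambda>h. frechet_derivative g (at ?y) (h *\<^sub>R w))) (at s)"
      by (rule has_derivative_compose[where f = "\<lambda>s. x + a *\<^sub>R v + s *\<^sub>R w" and x = s, OF _ D]) (auto intro!: derivative_eq_intros)
    moreover have "(\<lambda>h. frechet_derivative g (at ?y) (h *\<^sub>R w)) = (*) (frechet_derivative g (at ?y) w)"
      using linear_cmul[OF has_derivative_linear[OF D]] by auto
    ultimately show ?thesis by (simp add: has_field_derivative_def)
  qed
  have "\<exists>a>0. a < t \<and> (f (x + t *\<^sub>R v + t *\<^sub>R w) - f (x + t *\<^sub>R v + 0 *\<^sub>R w))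
         - (f (x + 0 *\<^sub>R v + t *\<^sub>R w) - f (x + 0 *\<^sub>R v + 0 *\<^sub>R w))
       = (t - 0) * (g (x + a *\<^sub>R v + t *\<^sub>R w) - g (x + a *\<^sub>R v + 0 *\<^sub>R w))"
    using t(1) by (intro MVT2 DERIV_diff Df) simp_all
  then obtain a where a: "0 < a" "a < t" and
    ea: "f (x + t *\<^sub>R v + t *\<^sub>R w) - f (x + t *\<^sub>R v) - f (x + t *\<^sub>R w) + f x
       = t * (g (x + a *\<^sub>R v + t *\<^sub>R w) - g (x + a *\<^sub>R v))"
    by auto
  have "\<exists>b>0. b < t \<and> g (x + a *\<^sub>R v + t *\<^sub>R w) - g (x + a *\<^sub>R v + 0 *\<^sub>R w)
       = (t - 0) * frechet_derivative g (at (x + a *\<^sub>R v + b *\<^sub>R w)) w"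
    using t(1) a by (intro MVT2 Dg) simp_all
  then obtain b where b: "0 < b" "b < t" and
    eb: "g (x + a *\<^sub>R v + t *\<^sub>R w) - g (x + a *\<^sub>R v)
       = t * frechet_derivative g (at (x + a *\<^sub>R v + b *\<^sub>R w)) w"
    by auto
  show ?thesis
    using ea eb near[of a b] a b
    by (intro exI[of _ "x + a *\<^sub>R v + b *\<^sub>R w"]) (simp add: g_def power2_eq_square)
qed

text \<open>For every small \<open>t\<close> the second difference is \<open>t\<^sup>2\<close> times a value of either mixed derivative near
  \<open>x\<close>. By continuity both values tend to those at \<open>x\<close> as \<open>t\<close> tends to 0.\<close>

lemma second_derivative_symmetric:
  fixes f :: "'a::real_normed_vector \<Rightarrow> real"
  assumes S: "open S" "x \<in> S" and f: "smooth_on S f"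
  shows "frechet_derivative (\<lambda>z. frechet_derivative f (at z) v) (at x) w
       = frechet_derivative (\<lambda>z. frechet_derivative f (at z) w) (at x) v"
proof -
  define G where "G = (\<lambda>v w y. frechet_derivative (\<lambda>z. frechet_derivative f (at z) v) (at y) w)"
  obtain r where r: "r > 0" "ball x r \<subseteq> S"
    using S openE by blast
  have cont: "isCont (G v w) x" for v w
    using smooth_on_continuous[OF smooth_on_derivative[OF smooth_on_derivative[OF f]]] S
    unfolding G_def by (simp add: continuous_on_eq_continuous_at)
  have diff: "f differentiable at y"
      "(\<lambda>z. frechet_derivative f (at z) v) differentiable at y" if "y \<in> ball x r" for y v
    using that r smooth_on_differentiable f smooth_on_derivative by blast+
  have "\<bar>G v w x - G w v x\<bar> < e" if e: "e > 0" for e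
  proof -
    obtain d1 where d1: "d1 > 0" "\<And>y. dist y x < d1 \<Longrightarrow> dist (G v w y) (G v w x) < e / 2"
      using cont[of v w] e unfolding continuous_at_eps_delta by (metis half_gt_zero)
    obtain d2 where d2: "d2 > 0" "\<And>y. dist y x < d2 \<Longrightarrow> dist (G w v y) (G w v x) < e / 2"
      using cont[of w v] e unfolding continuous_at_eps_delta by (metis half_gt_zero)
    define m where "m = min r (min d1 d2)"
    have m: "m > 0" using r d1 d2 by (simp add: m_def)
    \<comment> \<open>the summand 1 covers the case that both directions vanish\<close>
    define t where "t = m / (norm v + norm w + 1)"
    have p: "0 < norm v + norm w + 1" by (simp add: add_nonneg_pos)
    have t: "t > 0" "t * (norm v + norm w) < m" "t * (norm w + norm v) < m"
      using m p by (auto simp: t_def field_simps)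
    obtain y where y: "dist x y \<le> t * (norm v + norm w)"
        "f (x + t *\<^sub>R v + t *\<^sub>R w) - f (x + t *\<^sub>R v) - f (x + t *\<^sub>R w) + f x = t\<^sup>2 * G v w y"
      using second_difference_mean_value[of t v w r x f] t diff unfolding G_def m_def by auto
    obtain z where z: "dist x z \<le> t * (norm w + norm v)"
        "f (x + t *\<^sub>R w + t *\<^sub>R v) - f (x + t *\<^sub>R w) - f (x + t *\<^sub>R v) + f x = t\<^sup>2 * G w v z"
      using second_difference_mean_value[of t w v r x f] t diff unfolding G_def m_def by auto
    have "t\<^sup>2 * G v w y = t\<^sup>2 * G w v z"
      using y(2) z(2) by (simp add: algebra_simps)
    then have "G v w y = G w v z" using t(1) by simp
    moreover have "dist (G v w y) (G v w x) < e / 2"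
      using y(1) t by (intro d1(2)) (simp add: m_def dist_commute)
    moreover have "dist (G w v z) (G w v x) < e / 2"
      using z(1) t by (intro d2(2)) (simp add: m_def dist_commute)
    ultimately show ?thesis unfolding dist_real_def by linarith
  qed
  from this[of "\<bar>G v w x - G w v x\<bar>"] have "G v w x = G w v x" by (cases "G v w x = G w v x") auto
  then show ?thesis by (simp add: G_def)
qed

section \<open>Calculus in a chart\<close>

text \<open>Tensor components, connection coefficients and Gram matrices are all handled as functions with
  values in matrices, so that the index computations become matrix algebra.\<close>

definition smooth_matrix :: "('m, 'n::finite) chart \<Rightarrow> ('m \<Rightarrow> real ^ 'k ^ 'l) \<Rightarrow> bool"
  where "smooth_matrix c B \<longleftrightarrow> (\<forall>i j. smooth_in c (\<lambda>p. B p $ i $ j))"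

definition mderiv ::
    "('m, 'n::finite) chart \<Rightarrow> ('m, 'n) vector_comps \<Rightarrow> ('m \<Rightarrow> real ^ 'k ^ 'l) \<Rightarrow> 'm \<Rightarrow> real ^ 'k ^ 'l"
  where "mderiv c v B p = (\<chi> i j. vderiv c v (\<lambda>x. B x $ i $ j) p)"

locale coordinate_chart =
  fixes c :: "('m, 'n::finite) chart"
  assumes open_range: "open (snd c ` fst c)"
    and inj_coords: "inj_on (snd c) (fst c)"
begin

lemma inv_coords [simp]: "p \<in> fst c \<Longrightarrow> inv_into (fst c) (snd c) (snd c p) = p"
  using inj_coords by simp

lemma inv_coords_mem [simp]: "y \<in> snd c ` fst c \<Longrightarrow> inv_into (fst c) (snd c) y \<in> fst c"
  by (rule inv_into_into)

lemma smooth_in_cong: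
  assumes "smooth_in c f" "\<And>p. p \<in> fst c \<Longrightarrow> f p = g p"
  shows "smooth_in c g"
  using assms unfolding smooth_in_def by (elim smooth_on_cong[OF open_range]) auto

lemma smooth_in_const: "smooth_in c (\<lambda>p. a)"
  by (simp add: smooth_in_def smooth_on_def o_def Ck_on_const)

lemma smooth_in_add: "smooth_in c f \<Longrightarrow> smooth_in c g \<Longrightarrow> smooth_in c (\<lambda>p. f p + g p)"
  by (simp add: smooth_in_def smooth_on_def o_def Ck_on_add open_range)

lemma smooth_in_mult: "smooth_in c f \<Longrightarrow> smooth_in c g \<Longrightarrow> smooth_in c (\<lambda>p. f p * g p)"
  by (simp add: smooth_in_def smooth_on_def o_def Ck_on_mult open_range)

lemma smooth_in_inverse:
  "smooth_in c f \<Longrightarrow> (\<And>p. p \<in> fst c \<Longrightarrow> f p \<noteq> 0) \<Longrightarrow> smooth_in c (\<lambda>p. inverse (f p))"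
  by (simp add: smooth_in_def smooth_on_def o_def Ck_on_inverse open_range)

lemma smooth_in_diff: "smooth_in c f \<Longrightarrow> smooth_in c g \<Longrightarrow> smooth_in c (\<lambda>p. f p - g p)"
  using smooth_in_add[of f "\<lambda>p. (-1) * g p"] smooth_in_mult[OF smooth_in_const[of "-1"], of g] by simp

lemma smooth_in_sum: "(\<And>i. i \<in> I \<Longrightarrow> smooth_in c (f i)) \<Longrightarrow> smooth_in c (\<lambda>p. \<Sum>i\<in>I. f i p)"
  by (induction I rule: infinite_finite_induct) (auto intro: smooth_in_const smooth_in_add)

lemma smooth_in_prod: "(\<And>i. i \<in> I \<Longrightarrow> smooth_in c (f i)) \<Longrightarrow> smooth_in c (\<lambda>p. \<Prod>i\<in>I. f i p)"
  by (induction I rule: infinite_finite_induct) (auto intro: smooth_in_const smooth_in_mult)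

lemma smooth_in_chart_pd:
  assumes "smooth_in c f"
  shows "smooth_in c (chart_pd c \<mu> f)"
proof -
  have "smooth_on (snd c ` fst c)
      (\<lambda>y. frechet_derivative (f \<circ> inv_into (fst c) (snd c)) (at y) (axis \<mu> 1))"
    using assms unfolding smooth_in_def by (rule smooth_on_derivative)
  then show ?thesis
    unfolding smooth_in_def by (rule smooth_on_cong[OF open_range]) (auto simp: chart_pd_def)
qed

lemma smooth_in_has_derivative:
  assumes "smooth_in c f" "p \<in> fst c"
  shows "((\<lambda>y. f (inv_into (fst c) (snd c) y)) has_derivative
    frechet_derivative (\<lambda>y. f (inv_into (fst c) (snd c) y)) (at (snd c p))) (at (snd c p))"
  using assms smooth_on_differentiable[of "snd c ` fst c" _ "snd c p"]
  unfolding smooth_in_def frechet_derivative_works[symmetric] o_def by blast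

lemma chart_pd_cong:
  assumes "smooth_in c f" "\<And>x. x \<in> fst c \<Longrightarrow> f x = g x" "p \<in> fst c"
  shows "chart_pd c \<mu> f p = chart_pd c \<mu> g p"
proof -
  have "frechet_derivative (f \<circ> inv_into (fst c) (snd c)) (at (snd c p))
      = frechet_derivative (g \<circ> inv_into (fst c) (snd c)) (at (snd c p))"
    using assms open_range
    by (intro frechet_derivative_transform_within_open[where X = "snd c ` fst c"])
      (auto simp: smooth_in_def intro: smooth_on_differentiable)
  then show ?thesis by (simp add: chart_pd_def)
qed

lemma chart_pd_const: "chart_pd c \<mu> (\<lambda>x. a) p = 0"
  by (simp add: chart_pd_def o_def)

lemma chart_pd_add:
  assumes "smooth_in c f" "smooth_in c g" "p \<in> fst c"
  shows "chart_pd c \<mu> (\<lambda>x. f x + g x) p = chart_pd c \<mu> f p + chart_pd c \<mu> g p"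
  using frechet_derivative_at[OF has_derivative_add[OF smooth_in_has_derivative[OF assms(1,3)]
        smooth_in_has_derivative[OF assms(2,3)]], symmetric]
  by (simp add: chart_pd_def o_def)

lemma chart_pd_mult:
  assumes "smooth_in c f" "smooth_in c g" "p \<in> fst c"
  shows "chart_pd c \<mu> (\<lambda>x. f x * g x) p = chart_pd c \<mu> f p * g p + f p * chart_pd c \<mu> g p"
  using frechet_derivative_at[OF has_derivative_mult[OF smooth_in_has_derivative[OF assms(1,3)]
        smooth_in_has_derivative[OF assms(2,3)]], symmetric] assms(3)
  by (simp add: chart_pd_def o_def)

lemma chart_pd_commute:
  assumes "smooth_in c f" "p \<in> fst c"
  shows "chart_pd c \<nu> (chart_pd c \<mu> f) p = chart_pd c \<mu> (chart_pd c \<nu> f) p"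
proof -
  let ?f = "f \<circ> inv_into (fst c) (snd c)"
  have S: "smooth_on (snd c ` fst c) ?f"
    using assms(1) by (simp add: smooth_in_def)
  have "frechet_derivative (chart_pd c \<mu> f \<circ> inv_into (fst c) (snd c)) (at (snd c p))
      = frechet_derivative (\<lambda>y. frechet_derivative ?f (at y) (axis \<mu> 1)) (at (snd c p))" for \<mu>
    using smooth_in_chart_pd[OF assms(1), of \<mu>] assms(2) open_range
    by (intro frechet_derivative_transform_within_open[where X = "snd c ` fst c"])
      (auto simp: smooth_in_def chart_pd_def intro: smooth_on_differentiable)
  then show ?thesis
    using second_derivative_symmetric[OF open_range _ S, of "snd c p"] assms(2)
    by (simp add: chart_pd_def[of c _ "chart_pd c _ f"])
qed

subsection \<open>Derivatives along vector fields\<close>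

lemma vderiv_cong:
  assumes "smooth_in c f" "\<And>x. x \<in> fst c \<Longrightarrow> f x = g x" "p \<in> fst c"
  shows "vderiv c v f p = vderiv c v g p"
  unfolding vderiv_def using chart_pd_cong[OF assms] by simp

lemma vderiv_const: "vderiv c v (\<lambda>x. a) p = 0"
  by (simp add: vderiv_def chart_pd_const)

lemma vderiv_add:
  assumes "smooth_in c f" "smooth_in c g" "p \<in> fst c"
  shows "vderiv c v (\<lambda>x. f x + g x) p = vderiv c v f p + vderiv c v g p"
  by (simp add: vderiv_def chart_pd_add[OF assms] distrib_left sum.distrib)

lemma vderiv_mult:
  assumes "smooth_in c f" "smooth_in c g" "p \<in> fst c"
  shows "vderiv c v (\<lambda>x. f x * g x) p = vderiv c v f p * g p + f p * vderiv c v g p"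
  by (simp add: vderiv_def chart_pd_mult[OF assms] algebra_simps sum.distrib sum_distrib_left)

lemma vderiv_sum:
  assumes "finite I" "\<And>i. i \<in> I \<Longrightarrow> smooth_in c (f i)" "p \<in> fst c"
  shows "vderiv c v (\<lambda>x. \<Sum>i\<in>I. f i x) p = (\<Sum>i\<in>I. vderiv c v (f i) p)"
  using assms(1,2)
  by (induction I rule: finite_induct)
    (auto simp: vderiv_const vderiv_add[OF _ _ assms(3)] smooth_in_sum)

lemma smooth_in_vderiv:
  assumes "\<And>\<mu>. smooth_in c (\<lambda>x. v c x $ \<mu>)" "smooth_in c f"
  shows "smooth_in c (vderiv c v f)"
  unfolding vderiv_def[abs_def]
  by (intro smooth_in_sum smooth_in_mult assms smooth_in_chart_pd)

text \<open>Expanding both iterated derivatives gives first-order terms, which form the Lie bracket, and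
  second-order terms, which cancel by the symmetry of second derivatives.\<close>

lemma vderiv_commutator:
  assumes v: "\<And>\<mu>. smooth_in c (\<lambda>x. v c x $ \<mu>)" and w: "\<And>\<mu>. smooth_in c (\<lambda>x. w c x $ \<mu>)"
    and f: "smooth_in c f" and p: "p \<in> fst c"
  shows "vderiv c v (vderiv c w f) p - vderiv c w (vderiv c v f) p
    = (\<Sum>\<mu>\<in>UNIV. lie_bracket c v w p $ \<mu> * chart_pd c \<mu> f p)"
proof -
  have expand: "vderiv c v (vderiv c w f) p = (\<Sum>\<mu>\<in>UNIV. vderiv c v (\<lambda>x. w c x $ \<mu>) p * chart_pd c \<mu> f p)
      + (\<Sum>\<mu>\<in>UNIV. \<Sum>\<nu>\<in>UNIV. w c p $ \<mu> * v c p $ \<nu> * chart_pd c \<nu> (chart_pd c \<mu> f) p)"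
    if "\<And>\<mu>. smooth_in c (\<lambda>x. v c x $ \<mu>)" "\<And>\<mu>. smooth_in c (\<lambda>x. w c x $ \<mu>)" for v w
  proof -
    have "vderiv c v (vderiv c w f) p
        = (\<Sum>\<mu>\<in>UNIV. vderiv c v (\<lambda>x. w c x $ \<mu> * chart_pd c \<mu> f x) p)"
      unfolding vderiv_def[of c w, abs_def]
      by (intro vderiv_sum smooth_in_mult smooth_in_chart_pd that f p) simp
    also have "\<dots> = (\<Sum>\<mu>\<in>UNIV. vderiv c v (\<lambda>x. w c x $ \<mu>) p * chart_pd c \<mu> f p
        + w c p $ \<mu> * vderiv c v (chart_pd c \<mu> f) p)"
      by (intro sum.cong refl vderiv_mult smooth_in_chart_pd that f p)
    finally show ?thesis
      by (simp add: sum.distrib vderiv_def[of c v "chart_pd c _ f"] sum_distrib_left mult.assoc)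
  qed
  have "(\<Sum>\<mu>\<in>UNIV. \<Sum>\<nu>\<in>UNIV. w c p $ \<mu> * v c p $ \<nu> * chart_pd c \<nu> (chart_pd c \<mu> f) p)
      = (\<Sum>\<nu>\<in>UNIV. \<Sum>\<mu>\<in>UNIV. w c p $ \<mu> * v c p $ \<nu> * chart_pd c \<nu> (chart_pd c \<mu> f) p)"
    by (rule sum.swap)
  also have "\<dots> = (\<Sum>\<nu>\<in>UNIV. \<Sum>\<mu>\<in>UNIV. v c p $ \<nu> * w c p $ \<mu> * chart_pd c \<mu> (chart_pd c \<nu> f) p)"
    using chart_pd_commute[OF f p] by (simp add: mult.commute)
  finally show ?thesis
    using expand[of v w, OF v w] expand[of w v, OF w v]
    by (simp add: lie_bracket_def left_diff_distrib sum_subtractf)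
qed

subsection \<open>Matrix-valued functions\<close>

lemma smooth_matrix_add: "smooth_matrix c B \<Longrightarrow> smooth_matrix c D \<Longrightarrow> smooth_matrix c (\<lambda>p. B p + D p)"
  by (simp add: smooth_matrix_def smooth_in_add)

lemma smooth_matrix_diff: "smooth_matrix c B \<Longrightarrow> smooth_matrix c D \<Longrightarrow> smooth_matrix c (\<lambda>p. B p - D p)"
  by (simp add: smooth_matrix_def smooth_in_diff)

lemma smooth_matrix_transpose: "smooth_matrix c B \<Longrightarrow> smooth_matrix c (\<lambda>p. transpose (B p))"
  by (simp add: smooth_matrix_def transpose_def)

lemma smooth_matrix_mult: "smooth_matrix c B \<Longrightarrow> smooth_matrix c D \<Longrightarrow> smooth_matrix c (\<lambda>p. B p ** D p)"
  by (auto simp: smooth_matrix_def matrix_matrix_mult_def intro!: smooth_in_sum smooth_in_mult)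

lemma smooth_matrix_mderiv:
  "(\<And>\<mu>. smooth_in c (\<lambda>x. v c x $ \<mu>)) \<Longrightarrow> smooth_matrix c B \<Longrightarrow> smooth_matrix c (mderiv c v B)"
  by (auto simp: smooth_matrix_def mderiv_def intro!: smooth_in_vderiv)

lemma smooth_in_det:
  assumes "smooth_matrix c (B :: 'm \<Rightarrow> real ^ 'k ^ 'k)"
  shows "smooth_in c (\<lambda>p. det (B p))"
  using assms unfolding det_def smooth_matrix_def
  by (intro smooth_in_sum smooth_in_mult smooth_in_const smooth_in_prod) simp

lemma mderiv_mult:
  assumes "smooth_matrix c B" "smooth_matrix c D" "p \<in> fst c"
  shows "mderiv c v (\<lambda>x. B x ** D x) p = mderiv c v B p ** D p + B p ** mderiv c v D p"
proof -
  have "vderiv c v (\<lambda>x. \<Sum>k\<in>UNIV. B x $ i $ k * D x $ k $ j) p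
      = (\<Sum>k\<in>UNIV. vderiv c v (\<lambda>x. B x $ i $ k) p * D p $ k $ j
          + B p $ i $ k * vderiv c v (\<lambda>x. D x $ k $ j) p)" for i j
    using assms(1,2) unfolding smooth_matrix_def
    by (subst vderiv_sum[OF _ _ assms(3)]) (auto intro!: smooth_in_mult vderiv_mult assms(3) sum.cong)
  then show ?thesis
    by (simp add: mderiv_def matrix_matrix_mult_def vec_eq_iff sum.distrib)
qed

lemma mderiv_transpose: "mderiv c v (\<lambda>x. transpose (B x)) p = transpose (mderiv c v B p)"
  by (simp add: mderiv_def transpose_def vec_eq_iff)

lemma vderiv_bilinear:
  assumes q: "\<And>i. smooth_in c (\<lambda>x. q x $ i)" and r: "\<And>j. smooth_in c (\<lambda>x. r x $ j)"
    and B: "smooth_matrix c B" and p: "p \<in> fst c"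
  shows "vderiv c v (\<lambda>x. q x \<bullet> (B x *v r x)) p
    = (\<chi> i. vderiv c v (\<lambda>x. q x $ i) p) \<bullet> (B p *v r p) + q p \<bullet> (mderiv c v B p *v r p)
      + q p \<bullet> (B p *v (\<chi> j. vderiv c v (\<lambda>x. r x $ j) p))"
proof -
  have B': "smooth_in c (\<lambda>x. B x $ i $ j)" for i j
    using B by (simp add: smooth_matrix_def)
  have "vderiv c v (\<lambda>x. q x \<bullet> (B x *v r x)) p
      = (\<Sum>i\<in>UNIV. vderiv c v (\<lambda>x. q x $ i * (\<Sum>j\<in>UNIV. B x $ i $ j * r x $ j)) p)"
    unfolding inner_vec_def matrix_vector_mult_def
    by (simp, intro vderiv_sum smooth_in_mult smooth_in_sum q r B' p) simp
  also have "\<dots> = (\<Sum>i\<in>UNIV. vderiv c v (\<lambda>x. q x $ i) p * (\<Sum>j\<in>UNIV. B p $ i $ j * r p $ j)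
      + q p $ i * vderiv c v (\<lambda>x. \<Sum>j\<in>UNIV. B x $ i $ j * r x $ j) p)"
    by (intro sum.cong refl vderiv_mult smooth_in_mult smooth_in_sum q r B' p)
  also have "\<dots> = (\<Sum>i\<in>UNIV. vderiv c v (\<lambda>x. q x $ i) p * (\<Sum>j\<in>UNIV. B p $ i $ j * r p $ j)
      + q p $ i * (\<Sum>j\<in>UNIV. vderiv c v (\<lambda>x. B x $ i $ j) p * r p $ j
          + B p $ i $ j * vderiv c v (\<lambda>x. r x $ j) p))"
    by (subst vderiv_sum[OF _ _ p]) (auto intro!: sum.cong vderiv_mult smooth_in_mult r B' p)
  finally show ?thesis
    by (simp add: inner_vec_def matrix_vector_mult_def mderiv_def sum.distrib distrib_left)
qed

end

lemma invertible_matrix_inv: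
  assumes "invertible B"
  shows "B ** matrix_inv B = mat 1" "matrix_inv B ** B = mat 1"
  using someI_ex[of "\<lambda>B'. B ** B' = mat 1 \<and> B' ** B = mat 1"] assms
  unfolding matrix_inv_def invertible_def by auto

text \<open>Cramer's rule expresses the entries of the inverse as quotients of determinants, which are
  polynomials in the entries.\<close>

lemma (in coordinate_chart) smooth_matrix_inv:
  assumes B: "smooth_matrix c (B :: 'm \<Rightarrow> real ^ 'k ^ 'k)"
    and inv: "\<And>p. p \<in> fst c \<Longrightarrow> invertible (B p)"
  shows "smooth_matrix c (\<lambda>p. matrix_inv (B p))"
proof -
  have B': "smooth_in c (\<lambda>x. B x $ i $ j)" for i j
    using B by (simp add: smooth_matrix_def)
  have cramer_entry: "matrix_inv (B p) $ k $ l
      = det (\<chi> i j. if j = k then axis l 1 $ i else B p $ i $ j) * inverse (det (B p))"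
    if "p \<in> fst c" for p k l
  proof -
    have "B p *v (matrix_inv (B p) *v axis l 1) = axis l 1"
      using inv[OF that] by (simp add: matrix_vector_mul_assoc invertible_matrix_inv)
    then have "matrix_inv (B p) *v axis l 1
        = (\<chi> k. det (\<chi> i j. if j = k then axis l 1 $ i else B p $ i $ j) / det (B p))"
      using inv[OF that] by (simp add: cramer invertible_det_nz)
    then show ?thesis
      by (simp add: matrix_vector_mul_component vec_eq_iff matrix_vector_mult_basis column_def divide_inverse)
  qed
  have "smooth_in c (\<lambda>p. det (\<chi> i j. if j = k then axis l 1 $ i else B p $ i $ j) * inverse (det (B p)))"
    for k l :: 'k
  proof (intro smooth_in_mult smooth_in_inverse smooth_in_det B)
    have "smooth_in c (\<lambda>p. if j = k then axis l 1 $ i else B p $ i $ j)" for i j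
      by (cases "j = k") (auto intro: smooth_in_const B')
    then show "smooth_matrix c (\<lambda>p. \<chi> i j. if j = k then axis l 1 $ i else B p $ i $ j)"
      by (simp add: smooth_matrix_def)
  qed (use inv in \<open>simp add: invertible_det_nz\<close>)
  then show ?thesis
    unfolding smooth_matrix_def by (blast intro: smooth_in_cong cramer_entry[symmetric])
qed

section \<open>Matrix algebra\<close>

lemma matrix_add_rdistrib: "(A + B) ** D = A ** D + B ** (D :: real ^ 'k ^ 'l)"
  by (simp add: matrix_matrix_mult_def vec_eq_iff distrib_right sum.distrib)

lemma matrix_diff_ldistrib: "D ** (A - B) = D ** A - D ** (B :: real ^ 'k ^ 'l)"
  by (simp add: matrix_matrix_mult_def vec_eq_iff right_diff_distrib sum_subtractf)

lemma matrix_diff_rdistrib: "(A - B) ** D = A ** D - B ** (D :: real ^ 'k ^ 'l)"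
  by (simp add: matrix_matrix_mult_def vec_eq_iff left_diff_distrib sum_subtractf)

lemma transpose_add: "transpose (A + B) = transpose A + transpose (B :: real ^ 'k ^ 'l)"
  by (simp add: transpose_def vec_eq_iff)

lemma transpose_diff: "transpose (A - B) = transpose A - transpose (B :: real ^ 'k ^ 'l)"
  by (simp add: transpose_def vec_eq_iff)

lemmas matrix_ring_simps = matrix_add_ldistrib matrix_add_rdistrib matrix_diff_ldistrib
  matrix_diff_rdistrib transpose_add transpose_diff matrix_transpose_mul matrix_mul_assoc

lemma sum_scaleR_matrix_mult:
  fixes B :: "'i \<Rightarrow> real ^ 'l ^ 'j"
  shows "(\<Sum>a\<in>I. s a *\<^sub>R B a) ** D = (\<Sum>a\<in>I. s a *\<^sub>R (B a ** (D :: real ^ 'k ^ 'l)))"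
proof -
  have "(t *\<^sub>R M) ** D = t *\<^sub>R (M ** D)" for t :: real and M :: "real ^ 'l ^ 'j"
    by (simp add: matrix_matrix_mult_def vec_eq_iff sum_distrib_left mult.assoc)
  then show ?thesis
    by (induction I rule: infinite_finite_induct) (simp_all add: matrix_add_rdistrib)
qed

lemma matrix_mult_sum_scaleR:
  "D ** (\<Sum>a\<in>I. s a *\<^sub>R B a) = (\<Sum>a\<in>I. s a *\<^sub>R (D ** (B a :: real ^ 'k ^ 'l)))"
proof -
  have "D ** (t *\<^sub>R M) = t *\<^sub>R (D ** M)" for t :: real and M :: "real ^ 'k ^ 'l"
    by (simp add: matrix_matrix_mult_def vec_eq_iff sum_distrib_left mult.left_commute)
  then show ?thesis
    by (induction I rule: infinite_finite_induct) (simp_all add: matrix_add_ldistrib)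
qed

lemma transpose_sum_scaleR:
  "transpose (\<Sum>a\<in>I. s a *\<^sub>R B a) = (\<Sum>a\<in>I. s a *\<^sub>R transpose (B a :: real ^ 'k ^ 'l))"
proof -
  have "transpose (0 :: real ^ 'k ^ 'l) = 0"
    by (simp add: transpose_def vec_eq_iff)
  then show ?thesis
    by (induction I rule: infinite_finite_induct) (simp_all add: transpose_add transpose_scalar)
qed

lemma inner_transpose_matrix: "q \<bullet> (transpose B *v y) = (B *v q) \<bullet> (y :: real ^ 'k)"
  by (metis dot_lmul_matrix inner_commute transpose_matrix_vector)

text \<open>A bilinear form is determined by its values on a frame.\<close>

lemma matrix_congruence_cancel:
  assumes "invertible (R :: real ^ 'k ^ 'k)" "transpose R ** K ** R = transpose R ** L ** R"
  shows "K = L"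
proof -
  have *: "transpose (matrix_inv R) ** (transpose R ** M ** R) ** matrix_inv R = M" for M
    using invertible_matrix_inv[OF assms(1)]
    by (metis matrix_mul_assoc matrix_mul_lid matrix_mul_rid matrix_transpose_mul transpose_mat)
  from assms(2) show ?thesis by (metis *)
qed

section \<open>Connections in the anchored frame\<close>

definition coeff_matrix :: "('m, 'n::finite) TM_conn \<Rightarrow> 'n \<Rightarrow> ('m, 'n) chart \<Rightarrow> 'm \<Rightarrow> real ^ 'n ^ 'n"
  where "coeff_matrix \<Omega> a c p = (\<chi> b \<mu>. \<Omega> b a c p $ \<mu>)"

definition structure_matrix :: "('n::finite \<Rightarrow> 'n \<Rightarrow> 'n \<Rightarrow> 'm \<Rightarrow> real) \<Rightarrow> 'n \<Rightarrow> 'm \<Rightarrow> real ^ 'n ^ 'n"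
  where "structure_matrix C a p = (\<chi> d b. C d a b p)"

definition adjoint_matrix ::
    "('m, 'n::finite) chart \<Rightarrow> ('n \<Rightarrow> ('m, 'n) vector_comps) \<Rightarrow> ('n \<Rightarrow> 'n \<Rightarrow> 'n \<Rightarrow> 'm \<Rightarrow> real) \<Rightarrow>
     ('m, 'n) TM_conn \<Rightarrow> 'n \<Rightarrow> 'm \<Rightarrow> real ^ 'n ^ 'n"
  where "adjoint_matrix c \<rho> C \<Omega> a p = (\<chi> d b. adjoint_coeff c \<rho> C \<Omega> d a b p)"

lemma frame_comps_matrix:
  "frame_comps c E \<rho> p = transpose (anchor_matrix \<rho> c p) ** E c p ** anchor_matrix \<rho> c p"
proof -
  have "(\<Sum>\<mu>\<in>UNIV. \<Sum>\<nu>\<in>UNIV. \<rho> a c p $ \<mu> * E c p $ \<mu> $ \<nu> * \<rho> b c p $ \<nu>)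
      = (\<Sum>\<nu>\<in>UNIV. (\<Sum>\<mu>\<in>UNIV. \<rho> a c p $ \<mu> * E c p $ \<mu> $ \<nu>) * \<rho> b c p $ \<nu>)" for a b
    unfolding sum_distrib_right by (rule sum.swap)
  then show ?thesis
    by (simp add: frame_comps_def anchor_matrix_def matrix_matrix_mult_def transpose_def vec_eq_iff)
qed

text \<open>The anchor is linear over functions, so a derivative along it depends on the section only through
  its value at the point.\<close>

lemma vderiv_anchor:
  "vderiv c (anchor \<rho> q) f p = (\<Sum>a\<in>UNIV. q p $ a * vderiv c (\<rho> a) f p)"
proof -
  have "vderiv c (anchor \<rho> q) f p
      = (\<Sum>\<mu>\<in>UNIV. \<Sum>a\<in>UNIV. q p $ a * (\<rho> a c p $ \<mu> * chart_pd c \<mu> f p))"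
    by (simp add: vderiv_def anchor_def sum_distrib_right mult.assoc)
  also have "\<dots> = (\<Sum>a\<in>UNIV. \<Sum>\<mu>\<in>UNIV. q p $ a * (\<rho> a c p $ \<mu> * chart_pd c \<mu> f p))"
    by (rule sum.swap)
  finally show ?thesis
    by (simp add: vderiv_def sum_distrib_left)
qed

lemma mderiv_anchor:
  "mderiv c (anchor \<rho> q) B p = (\<Sum>a\<in>UNIV. q p $ a *\<^sub>R mderiv c (\<rho> a) B p)"
  by (simp add: mderiv_def vderiv_anchor vec_eq_iff)

lemma lie_derivative_matrix:
  "lie_derivative c v E p = mderiv c v (E c) p
    + transpose (\<chi> \<tau> \<mu>. chart_pd c \<mu> (\<lambda>x. v c x $ \<tau>) p) ** E c p
    + E c p ** (\<chi> \<tau> \<mu>. chart_pd c \<mu> (\<lambda>x. v c x $ \<tau>) p)"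
  by (simp add: lie_derivative_def mderiv_def matrix_matrix_mult_def transpose_def vec_eq_iff mult.commute)

lemma generalised_Killing_matrix:
  "generalised_Killing A E \<rho> \<Omega>p \<Omega>m \<longleftrightarrow> (\<forall>c\<in>A. \<forall>p\<in>fst c. \<forall>a.
    lie_derivative c (\<rho> a) E p = E c p ** anchor_matrix \<rho> c p ** coeff_matrix \<Omega>p a c p
      + transpose (anchor_matrix \<rho> c p ** coeff_matrix \<Omega>m a c p) ** E c p)"
proof -
  have 1: "(\<Sum>\<tau>\<in>UNIV. \<Sum>b\<in>UNIV. E c p $ \<mu> $ \<tau> * \<rho> b c p $ \<tau> * \<Omega>p b a c p $ \<nu>)
      = (E c p ** anchor_matrix \<rho> c p ** coeff_matrix \<Omega>p a c p) $ \<mu> $ \<nu>" for c p a \<mu> \<nu>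
    by (simp add: matrix_matrix_mult_def anchor_matrix_def coeff_matrix_def sum_distrib_right)
      (rule sum.swap)
  have 2: "(\<Sum>\<tau>\<in>UNIV. \<Sum>b\<in>UNIV. E c p $ \<tau> $ \<nu> * \<rho> b c p $ \<tau> * \<Omega>m b a c p $ \<mu>)
      = (transpose (anchor_matrix \<rho> c p ** coeff_matrix \<Omega>m a c p) ** E c p) $ \<mu> $ \<nu>" for c p a \<mu> \<nu>
    by (simp add: matrix_matrix_mult_def anchor_matrix_def coeff_matrix_def transpose_def
        sum_distrib_right sum_distrib_left mult.commute mult.left_commute)
  show ?thesis
    unfolding generalised_Killing_def 1 2 by (simp add: vec_eq_iff)
qed

context coordinate_chart
begin

text \<open>The derivative of the first argument \<open>q\<close> along the anchor of \<open>r\<close> occurs in the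
  \<open>TM\<close>-connection and, with the opposite sign, in the bracket. What is left is a genuine
  \<open>Q\<close>-connection, linear over functions in \<open>q\<close>.\<close>

lemma adjoint_nabla_component:
  "adjoint_nabla c \<rho> C \<Omega> q r p $ d = vderiv c (anchor \<rho> q) (\<lambda>x. r x $ d) p
    + (\<Sum>a\<in>UNIV. \<Sum>b\<in>UNIV. q p $ a * r p $ b * ((\<Sum>\<mu>\<in>UNIV. \<Omega> d a c p $ \<mu> * \<rho> b c p $ \<mu>) + C d a b p))"
proof -
  have "(\<Sum>a\<in>UNIV. \<Sum>\<mu>\<in>UNIV. anchor \<rho> r c p $ \<mu> * \<Omega> d a c p $ \<mu> * q p $ a)
      = (\<Sum>a\<in>UNIV. \<Sum>\<mu>\<in>UNIV. \<Sum>b\<in>UNIV. q p $ a * r p $ b * (\<Omega> d a c p $ \<mu> * \<rho> b c p $ \<mu>))"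
    by (simp add: anchor_def sum_distrib_right sum_distrib_left mult_ac)
  also have "\<dots> = (\<Sum>a\<in>UNIV. \<Sum>b\<in>UNIV. \<Sum>\<mu>\<in>UNIV. q p $ a * r p $ b * (\<Omega> d a c p $ \<mu> * \<rho> b c p $ \<mu>))"
    by (intro sum.cong refl sum.swap)
  finally show ?thesis
    by (simp add: adjoint_nabla_def TM_nabla_def Q_bracket_def distrib_left sum.distrib
        sum_distrib_left mult_ac)
qed

lemma adjoint_matrix_eq:
  "adjoint_matrix c \<rho> C \<Omega> a p
    = coeff_matrix \<Omega> a c p ** anchor_matrix \<rho> c p + structure_matrix C a p"
proof -
  have "adjoint_coeff c \<rho> C \<Omega> d a b p = (\<Sum>\<mu>\<in>UNIV. \<Omega> d a c p $ \<mu> * \<rho> b c p $ \<mu>) + C d a b p" for d b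
    by (simp add: adjoint_coeff_def adjoint_nabla_component Q_frame_def vderiv_const axis_def
        if_distrib[of "\<lambda>x. x * _"] if_distrib[of "\<lambda>x. _ * x"] cong: if_cong)
  then show ?thesis
    by (simp add: adjoint_matrix_def coeff_matrix_def anchor_matrix_def structure_matrix_def
        matrix_matrix_mult_def vec_eq_iff)
qed

lemma adjoint_nabla_matrix:
  "adjoint_nabla c \<rho> C \<Omega> q r p = (\<chi> d. vderiv c (anchor \<rho> q) (\<lambda>x. r x $ d) p)
    + (\<Sum>a\<in>UNIV. q p $ a *\<^sub>R adjoint_matrix c \<rho> C \<Omega> a p) *v r p"
proof -
  have "(\<Sum>a\<in>UNIV. \<Sum>b\<in>UNIV. q p $ a * r p $ b * adjoint_matrix c \<rho> C \<Omega> a p $ d $ b)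
      = (\<Sum>b\<in>UNIV. (\<Sum>a\<in>UNIV. q p $ a * adjoint_matrix c \<rho> C \<Omega> a p $ d $ b) * r p $ b)" for d
    unfolding sum_distrib_right by (subst sum.swap) (simp add: mult_ac)
  then show ?thesis
    by (simp add: vec_eq_iff adjoint_nabla_component matrix_vector_mult_def adjoint_matrix_eq
        coeff_matrix_def anchor_matrix_def structure_matrix_def matrix_matrix_mult_def)
qed

end

locale chart_frame = coordinate_chart c for c :: "('m, 'n::finite) chart" +
  fixes \<rho> :: "'n \<Rightarrow> ('m, 'n) vector_comps" and C :: "'n \<Rightarrow> 'n \<Rightarrow> 'n \<Rightarrow> 'm \<Rightarrow> real"
    and E :: "('m, 'n) tensor2_comps"
  assumes smooth_frame: "smooth_in c (\<lambda>x. \<rho> a c x $ \<mu>)"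
    and smooth_structure: "smooth_in c (C d a b)"
    and smooth_metric: "smooth_in c (\<lambda>x. E c x $ \<mu> $ \<nu>)"
    and frame_bracket: "p \<in> fst c \<Longrightarrow> lie_bracket c (\<rho> a) (\<rho> b) p = (\<Sum>d\<in>UNIV. C d a b p *\<^sub>R \<rho> d c p)"
    and invertible_frame: "p \<in> fst c \<Longrightarrow> invertible (anchor_matrix \<rho> c p)"
    and invertible_metric: "p \<in> fst c \<Longrightarrow> invertible (E c p)"
begin

lemma smooth_anchor_matrix: "smooth_matrix c (anchor_matrix \<rho> c)"
  by (simp add: smooth_matrix_def anchor_matrix_def smooth_frame)

lemma smooth_structure_matrix: "smooth_matrix c (structure_matrix C a)"
  by (simp add: smooth_matrix_def structure_matrix_def smooth_structure)

lemma smooth_E: "smooth_matrix c (E c)"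
  by (simp add: smooth_matrix_def smooth_metric)

lemma smooth_frame_comps: "smooth_matrix c (frame_comps c E \<rho>)"
  unfolding frame_comps_matrix[abs_def]
  by (intro smooth_matrix_mult smooth_matrix_transpose smooth_anchor_matrix smooth_E)

lemma invertible_frame_comps: "p \<in> fst c \<Longrightarrow> invertible (frame_comps c E \<rho> p)"
  unfolding frame_comps_matrix
  by (intro invertible_mult transpose_invertible invertible_frame invertible_metric)

lemma smooth_anchor: "(\<And>a. smooth_in c (\<lambda>x. q x $ a)) \<Longrightarrow> smooth_in c (\<lambda>x. anchor \<rho> q c x $ \<mu>)"
  by (auto simp: anchor_def intro!: smooth_in_sum smooth_in_mult smooth_frame)

text \<open>The structure functions of the Lie algebroid are those of the frame, and both brackets obey the
  same Leibniz rule, so agreement on the frame extends to all sections.\<close>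

lemma lie_bracket_anchor:
  assumes q: "\<And>a. smooth_in c (\<lambda>x. q x $ a)" and r: "\<And>a. smooth_in c (\<lambda>x. r x $ a)"
    and p: "p \<in> fst c"
  shows "lie_bracket c (anchor \<rho> q) (anchor \<rho> r) p = anchor \<rho> (Q_bracket c \<rho> C q r) c p"
proof -
  have expand: "vderiv c (anchor \<rho> q) (\<lambda>x. anchor \<rho> r c x $ \<mu>) p
      = (\<Sum>b\<in>UNIV. vderiv c (anchor \<rho> q) (\<lambda>x. r x $ b) p * \<rho> b c p $ \<mu>)
        + (\<Sum>a\<in>UNIV. \<Sum>b\<in>UNIV. q p $ a * r p $ b * vderiv c (\<rho> a) (\<lambda>x. \<rho> b c x $ \<mu>) p)"
    if r: "\<And>a. smooth_in c (\<lambda>x. r x $ a)" for q r \<mu>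
  proof -
    have "vderiv c (anchor \<rho> q) (\<lambda>x. anchor \<rho> r c x $ \<mu>) p
        = (\<Sum>b\<in>UNIV. vderiv c (anchor \<rho> q) (\<lambda>x. r x $ b * \<rho> b c x $ \<mu>) p)"
      unfolding anchor_def[of \<rho> r] by (simp, intro vderiv_sum smooth_in_mult smooth_frame r p) simp
    also have "\<dots> = (\<Sum>b\<in>UNIV. vderiv c (anchor \<rho> q) (\<lambda>x. r x $ b) p * \<rho> b c p $ \<mu>
        + r p $ b * vderiv c (anchor \<rho> q) (\<lambda>x. \<rho> b c x $ \<mu>) p)"
      by (intro sum.cong refl vderiv_mult smooth_frame r p)
    also have "\<dots> = (\<Sum>b\<in>UNIV. vderiv c (anchor \<rho> q) (\<lambda>x. r x $ b) p * \<rho> b c p $ \<mu>)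
        + (\<Sum>b\<in>UNIV. \<Sum>a\<in>UNIV. q p $ a * r p $ b * vderiv c (\<rho> a) (\<lambda>x. \<rho> b c x $ \<mu>) p)"
      by (simp add: sum.distrib vderiv_anchor[of c \<rho> q "\<lambda>x. \<rho> _ c x $ \<mu>"] sum_distrib_left mult_ac)
    finally show ?thesis by (subst sum.swap)
  qed
  have swap: "(\<Sum>a\<in>UNIV. \<Sum>b\<in>UNIV. r p $ a * q p $ b * vderiv c (\<rho> a) (\<lambda>x. \<rho> b c x $ \<mu>) p)
      = (\<Sum>a\<in>UNIV. \<Sum>b\<in>UNIV. q p $ a * r p $ b * vderiv c (\<rho> b) (\<lambda>x. \<rho> a c x $ \<mu>) p)" for \<mu>
    by (subst sum.swap) (simp add: mult_ac)
  have C: "vderiv c (\<rho> a) (\<lambda>x. \<rho> b c x $ \<mu>) p - vderiv c (\<rho> b) (\<lambda>x. \<rho> a c x $ \<mu>) p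
      = (\<Sum>d\<in>UNIV. C d a b p * \<rho> d c p $ \<mu>)" for a b \<mu>
    using arg_cong[OF frame_bracket[OF p, of a b], of "\<lambda>v. v $ \<mu>"] by (simp add: lie_bracket_def)
  have "(\<Sum>a\<in>UNIV. \<Sum>b\<in>UNIV. q p $ a * r p $ b * (\<Sum>d\<in>UNIV. C d a b p * \<rho> d c p $ \<mu>))
      = (\<Sum>d\<in>UNIV. (\<Sum>a\<in>UNIV. \<Sum>b\<in>UNIV. C d a b p * q p $ a * r p $ b) * \<rho> d c p $ \<mu>)" for \<mu>
  proof -
    have "(\<Sum>a\<in>UNIV. \<Sum>b\<in>UNIV. q p $ a * r p $ b * (\<Sum>d\<in>UNIV. C d a b p * \<rho> d c p $ \<mu>))
        = (\<Sum>a\<in>UNIV. \<Sum>b\<in>UNIV. \<Sum>d\<in>UNIV. C d a b p * q p $ a * r p $ b * \<rho> d c p $ \<mu>)"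
      by (simp add: sum_distrib_left mult_ac)
    also have "\<dots> = (\<Sum>a\<in>UNIV. \<Sum>d\<in>UNIV. \<Sum>b\<in>UNIV. C d a b p * q p $ a * r p $ b * \<rho> d c p $ \<mu>)"
      by (intro sum.cong refl sum.swap)
    also have "\<dots> = (\<Sum>d\<in>UNIV. \<Sum>a\<in>UNIV. \<Sum>b\<in>UNIV. C d a b p * q p $ a * r p $ b * \<rho> d c p $ \<mu>)"
      by (rule sum.swap)
    finally show ?thesis by (simp add: sum_distrib_right)
  qed
  then have C_sum: "(\<Sum>a\<in>UNIV. \<Sum>b\<in>UNIV. q p $ a * r p $ b * vderiv c (\<rho> a) (\<lambda>x. \<rho> b c x $ \<mu>) p)
      - (\<Sum>a\<in>UNIV. \<Sum>b\<in>UNIV. q p $ a * r p $ b * vderiv c (\<rho> b) (\<lambda>x. \<rho> a c x $ \<mu>) p)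
      = (\<Sum>d\<in>UNIV. (\<Sum>a\<in>UNIV. \<Sum>b\<in>UNIV. C d a b p * q p $ a * r p $ b) * \<rho> d c p $ \<mu>)" for \<mu>
    unfolding C[symmetric] by (simp add: right_diff_distrib sum_subtractf)
  have "lie_bracket c (anchor \<rho> q) (anchor \<rho> r) p $ \<mu> = anchor \<rho> (Q_bracket c \<rho> C q r) c p $ \<mu>" for \<mu>
  proof -
    have "anchor \<rho> (Q_bracket c \<rho> C q r) c p $ \<mu>
        = (\<Sum>d\<in>UNIV. vderiv c (anchor \<rho> q) (\<lambda>x. r x $ d) p * \<rho> d c p $ \<mu>)
          - (\<Sum>d\<in>UNIV. vderiv c (anchor \<rho> r) (\<lambda>x. q x $ d) p * \<rho> d c p $ \<mu>)
          + (\<Sum>d\<in>UNIV. (\<Sum>a\<in>UNIV. \<Sum>b\<in>UNIV. C d a b p * q p $ a * r p $ b) * \<rho> d c p $ \<mu>)"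
      by (simp add: anchor_def[of \<rho> "Q_bracket c \<rho> C q r"] Q_bracket_def distrib_right
          left_diff_distrib sum.distrib sum_subtractf)
    then show ?thesis
      using C_sum[of \<mu>]
      by (simp add: lie_bracket_def expand[of r q \<mu>, OF r] expand[of q r \<mu>, OF q] swap)
  qed
  then show ?thesis by (simp add: vec_eq_iff)
qed

lemma anchor_commutator:
  assumes q: "\<And>a. smooth_in c (\<lambda>x. q x $ a)" and r: "\<And>a. smooth_in c (\<lambda>x. r x $ a)"
    and f: "smooth_in c f" and p: "p \<in> fst c"
  shows "vderiv c (anchor \<rho> q) (vderiv c (anchor \<rho> r) f) p
      - vderiv c (anchor \<rho> r) (vderiv c (anchor \<rho> q) f) p
    = vderiv c (anchor \<rho> (Q_bracket c \<rho> C q r)) f p"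
  using vderiv_commutator[of "anchor \<rho> q" "anchor \<rho> r", OF smooth_anchor[of q, OF q] smooth_anchor[of r, OF r] f p]
  by (simp add: lie_bracket_anchor[OF q r p] vderiv_def)

text \<open>This is the Leibniz rule \<open>(L\<^sub>v E)(y,z) = v(E(y,z)) - E([v,y],z) - E(y,[v,z])\<close> on frame fields. In
  matrix form, the derivative of the frame along \<open>\<rho>\<^sub>a\<close> splits into the coordinate derivatives of \<open>\<rho>\<^sub>a\<close>,
  which the Lie derivative of \<open>E\<close> absorbs, and the brackets.\<close>

lemma frame_lie_derivative:
  assumes p: "p \<in> fst c"
  shows "transpose (anchor_matrix \<rho> c p) ** lie_derivative c (\<rho> a) E p ** anchor_matrix \<rho> c p
    = mderiv c (\<rho> a) (frame_comps c E \<rho>) p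
      - transpose (structure_matrix C a p) ** frame_comps c E \<rho> p
      - frame_comps c E \<rho> p ** structure_matrix C a p"
proof -
  let ?R = "anchor_matrix \<rho> c"
  define P where "P = (\<chi> \<tau> \<mu>. chart_pd c \<mu> (\<lambda>x. \<rho> a c x $ \<tau>) p)"
  \<comment> \<open>involutivity, read as a formula for the derivative of the frame along its own member\<close>
  have "vderiv c (\<rho> a) (\<lambda>x. \<rho> b c x $ \<mu>) p = vderiv c (\<rho> b) (\<lambda>x. \<rho> a c x $ \<mu>) p
      + (\<Sum>d\<in>UNIV. C d a b p * \<rho> d c p $ \<mu>)" for b \<mu>
    using arg_cong[OF frame_bracket[OF p, of a b], of "\<lambda>v. v $ \<mu>"] by (simp add: lie_bracket_def)
  then have R: "mderiv c (\<rho> a) ?R p = P ** ?R p + ?R p ** structure_matrix C a p"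
    by (simp add: mderiv_def anchor_matrix_def structure_matrix_def P_def matrix_matrix_mult_def
        vec_eq_iff vderiv_def[of c _ "\<lambda>x. \<rho> a c x $ _"] mult.commute)
  have "mderiv c (\<rho> a) (frame_comps c E \<rho>) p
      = transpose (mderiv c (\<rho> a) ?R p) ** E c p ** ?R p
        + transpose (?R p) ** mderiv c (\<rho> a) (E c) p ** ?R p
        + transpose (?R p) ** E c p ** mderiv c (\<rho> a) ?R p"
    unfolding frame_comps_matrix[abs_def]
    by (simp add: mderiv_mult mderiv_transpose smooth_matrix_mult smooth_matrix_transpose
        smooth_anchor_matrix smooth_E p matrix_ring_simps)
  then show ?thesis
    by (simp add: R lie_derivative_matrix P_def[symmetric] frame_comps_matrix matrix_ring_simps)
qed

text \<open>The Leibniz rule for the pairing of two frame sections. The form \<open>E\<close> may have an antisymmetric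
  part, so the order matters: \<open>\<Omega>m\<close> acts on the first argument and \<open>\<Omega>p\<close> on the second.\<close>

definition metric_dual :: "('m, 'n) TM_conn \<Rightarrow> ('m, 'n) TM_conn \<Rightarrow> bool"
  where "metric_dual \<Omega>m \<Omega>p \<longleftrightarrow> (\<forall>p\<in>fst c. \<forall>a.
    mderiv c (\<rho> a) (frame_comps c E \<rho>) p
      = transpose (adjoint_matrix c \<rho> C \<Omega>m a p) ** frame_comps c E \<rho> p
        + frame_comps c E \<rho> p ** adjoint_matrix c \<rho> C \<Omega>p a p)"

text \<open>Contracting with the frame on both sides is invertible. It turns the right-hand side of the
  Killing equation into \<open>E\<close> composed with the adjoint matrices, up to the structure matrices, and
  those are the ones produced by the Lie derivative.\<close>

lemma Killing_iff_metric_dual: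
  "generalised_Killing {c} E \<rho> \<Omega>p \<Omega>m \<longleftrightarrow> metric_dual \<Omega>m \<Omega>p"
proof -
  have "lie_derivative c (\<rho> a) E p = E c p ** anchor_matrix \<rho> c p ** coeff_matrix \<Omega>p a c p
        + transpose (anchor_matrix \<rho> c p ** coeff_matrix \<Omega>m a c p) ** E c p
      \<longleftrightarrow> mderiv c (\<rho> a) (frame_comps c E \<rho>) p
        = transpose (adjoint_matrix c \<rho> C \<Omega>m a p) ** frame_comps c E \<rho> p
          + frame_comps c E \<rho> p ** adjoint_matrix c \<rho> C \<Omega>p a p"
    (is "?L = ?K \<longleftrightarrow> ?D") if p: "p \<in> fst c" for p a
  proof -
    let ?R = "anchor_matrix \<rho> c p"
    have "?L = ?K \<longleftrightarrow> transpose ?R ** ?L ** ?R = transpose ?R ** ?K ** ?R"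
      using matrix_congruence_cancel[OF invertible_frame[OF p], of ?L ?K] by (auto simp only:)
    moreover have "transpose ?R ** ?K ** ?R = frame_comps c E \<rho> p ** (coeff_matrix \<Omega>p a c p ** ?R)
        + transpose (coeff_matrix \<Omega>m a c p ** ?R) ** frame_comps c E \<rho> p"
      by (simp add: frame_comps_matrix matrix_ring_simps)
    ultimately show ?thesis
      unfolding frame_lie_derivative[OF p] adjoint_matrix_eq
      by (simp add: matrix_ring_simps algebra_simps)
  qed
  then show ?thesis
    by (simp add: generalised_Killing_matrix metric_dual_def)
qed

text \<open>Duality on the frame extends to all sections, because both sides are linear over functions in
  \<open>s\<close> and derivations in \<open>q\<close> and \<open>r\<close>.\<close>

lemma metric_dual_Leibniz:
  assumes dual: "metric_dual \<Omega>m \<Omega>p"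
    and q: "\<And>a. smooth_in c (\<lambda>x. q x $ a)" and r: "\<And>a. smooth_in c (\<lambda>x. r x $ a)"
    and p: "p \<in> fst c"
  shows "vderiv c (anchor \<rho> s) (\<lambda>x. q x \<bullet> (frame_comps c E \<rho> x *v r x)) p
    = adjoint_nabla c \<rho> C \<Omega>m s q p \<bullet> (frame_comps c E \<rho> p *v r p)
      + q p \<bullet> (frame_comps c E \<rho> p *v adjoint_nabla c \<rho> C \<Omega>p s r p)"
proof -
  define Nm where "Nm = (\<Sum>a\<in>UNIV. s p $ a *\<^sub>R adjoint_matrix c \<rho> C \<Omega>m a p)"
  define Np where "Np = (\<Sum>a\<in>UNIV. s p $ a *\<^sub>R adjoint_matrix c \<rho> C \<Omega>p a p)"
  have "mderiv c (anchor \<rho> s) (frame_comps c E \<rho>) p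
      = transpose Nm ** frame_comps c E \<rho> p + frame_comps c E \<rho> p ** Np"
    using dual p
    by (simp add: mderiv_anchor metric_dual_def Nm_def Np_def transpose_sum_scaleR
        sum_scaleR_matrix_mult matrix_mult_sum_scaleR scaleR_add_right sum.distrib)
  then have "q p \<bullet> (mderiv c (anchor \<rho> s) (frame_comps c E \<rho>) p *v r p)
      = (Nm *v q p) \<bullet> (frame_comps c E \<rho> p *v r p) + q p \<bullet> (frame_comps c E \<rho> p *v (Np *v r p))"
    by (simp add: matrix_vector_mult_add_rdistrib inner_add_right matrix_vector_mul_assoc[symmetric]
        inner_transpose_matrix del: transpose_matrix_vector)
  then show ?thesis
    unfolding adjoint_nabla_matrix Nm_def[symmetric] Np_def[symmetric]
    by (subst vderiv_bilinear[OF q r smooth_frame_comps p])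
      (simp add: inner_add_left inner_add_right matrix_vector_right_distrib)
qed

lemma smooth_adjoint_nabla:
  assumes \<Omega>: "\<And>d a \<mu>. smooth_in c (\<lambda>x. \<Omega> d a c x $ \<mu>)"
    and q: "\<And>a. smooth_in c (\<lambda>x. q x $ a)" and r: "\<And>a. smooth_in c (\<lambda>x. r x $ a)"
  shows "smooth_in c (\<lambda>x. adjoint_nabla c \<rho> C \<Omega> q r x $ d)"
  unfolding adjoint_nabla_component
  by (intro smooth_in_add smooth_in_vderiv smooth_in_sum smooth_in_mult smooth_anchor
      smooth_frame smooth_structure \<Omega> q r)

lemma smooth_pairing:
  assumes q: "\<And>a. smooth_in c (\<lambda>x. q x $ a)" and r: "\<And>a. smooth_in c (\<lambda>x. r x $ a)"
  shows "smooth_in c (\<lambda>x. q x \<bullet> (frame_comps c E \<rho> x *v r x))"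
  using smooth_frame_comps unfolding smooth_matrix_def inner_vec_def matrix_vector_mult_def
  by (auto intro!: smooth_in_sum smooth_in_mult q r)

abbreviation curvature :: "('m, 'n) TM_conn \<Rightarrow> ('m, 'n) Q_section \<Rightarrow> ('m, 'n) Q_section \<Rightarrow>
    ('m, 'n) Q_section \<Rightarrow> 'm \<Rightarrow> real ^ 'n"
  where "curvature \<Omega> q1 q2 q3 p \<equiv>
    adjoint_nabla c \<rho> C \<Omega> q1 (adjoint_nabla c \<rho> C \<Omega> q2 q3) p
    - adjoint_nabla c \<rho> C \<Omega> q2 (adjoint_nabla c \<rho> C \<Omega> q1 q3) p
    - adjoint_nabla c \<rho> C \<Omega> (Q_bracket c \<rho> C q1 q2) q3 p"

text \<open>Differentiate the pairing of \<open>q\<close> and \<open>r\<close> along \<open>q1\<close> and \<open>q2\<close> in both orders. The mixed terms,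
  with one derivative on each factor, are symmetric in \<open>q1\<close> and \<open>q2\<close> and drop out of the difference;
  the commutator of the derivatives is the derivative along the bracket, to which the Leibniz
  rule applies once more.\<close>

lemma metric_dual_curvature:
  assumes dual: "metric_dual \<Omega>m \<Omega>p"
    and \<Omega>m: "\<And>d a \<mu>. smooth_in c (\<lambda>x. \<Omega>m d a c x $ \<mu>)"
    and \<Omega>p: "\<And>d a \<mu>. smooth_in c (\<lambda>x. \<Omega>p d a c x $ \<mu>)"
    and q1: "\<And>a. smooth_in c (\<lambda>x. q1 x $ a)" and q2: "\<And>a. smooth_in c (\<lambda>x. q2 x $ a)"
    and q: "\<And>a. smooth_in c (\<lambda>x. q x $ a)" and r: "\<And>a. smooth_in c (\<lambda>x. r x $ a)"
    and p: "p \<in> fst c"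
  shows "curvature \<Omega>m q1 q2 q p \<bullet> (frame_comps c E \<rho> p *v r p)
    + q p \<bullet> (frame_comps c E \<rho> p *v curvature \<Omega>p q1 q2 r p) = 0"
proof -
  define B where "B = (\<lambda>q r x. q x \<bullet> (frame_comps c E \<rho> x *v (r x :: real ^ 'n)))"
  let ?m = "adjoint_nabla c \<rho> C \<Omega>m" and ?p = "adjoint_nabla c \<rho> C \<Omega>p"
  have second: "vderiv c (anchor \<rho> s) (vderiv c (anchor \<rho> t) (B q r)) p
      = B (?m s (?m t q)) r p + B (?m t q) (?p s r) p + (B (?m s q) (?p t r) p + B q (?p s (?p t r)) p)"
    if s: "\<And>a. smooth_in c (\<lambda>x. s x $ a)" and t: "\<And>a. smooth_in c (\<lambda>x. t x $ a)" for s t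
  proof -
    note m = smooth_adjoint_nabla[of \<Omega>m t q, OF \<Omega>m t q] and p' = smooth_adjoint_nabla[of \<Omega>p t r, OF \<Omega>p t r]
    have "vderiv c (anchor \<rho> s) (vderiv c (anchor \<rho> t) (B q r)) p
        = vderiv c (anchor \<rho> s) (\<lambda>x. B (?m t q) r x + B q (?p t r) x) p"
      using smooth_in_vderiv[of "anchor \<rho> t", OF smooth_anchor[of t, OF t] smooth_pairing[OF q r]]
      by (intro vderiv_cong[OF _ _ p]) (auto simp: B_def metric_dual_Leibniz[OF dual q r])
    also have "\<dots> = vderiv c (anchor \<rho> s) (B (?m t q) r) p + vderiv c (anchor \<rho> s) (B q (?p t r)) p"
      unfolding B_def by (intro vderiv_add smooth_pairing m p' q r p)
    also have "\<dots> = B (?m s (?m t q)) r p + B (?m t q) (?p s r) p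
        + (B (?m s q) (?p t r) p + B q (?p s (?p t r)) p)"
      unfolding B_def
      by (simp only: metric_dual_Leibniz[OF dual m r p] metric_dual_Leibniz[OF dual q p' p])
    finally show ?thesis .
  qed
  have "vderiv c (anchor \<rho> (Q_bracket c \<rho> C q1 q2)) (B q r) p
      = B (?m (Q_bracket c \<rho> C q1 q2) q) r p + B q (?p (Q_bracket c \<rho> C q1 q2) r) p"
    unfolding B_def by (rule metric_dual_Leibniz[OF dual q r p])
  moreover have "smooth_in c (B q r)"
    unfolding B_def by (rule smooth_pairing[OF q r])
  ultimately show ?thesis
    using anchor_commutator[OF q1 q2 _ p, of "B q r"] second[of q1 q2, OF q1 q2] second[of q2 q1, OF q2 q1]
    by (simp add: B_def inner_diff_left inner_diff_right matrix_vector_mult_diff_distrib)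
qed

text \<open>Pairing with each frame section shows that the Gram matrix annihilates the curvature of \<open>\<Omega>p\<close>.\<close>

lemma flat_metric_dual:
  assumes dual: "metric_dual \<Omega>m \<Omega>p"
    and \<Omega>m: "\<And>d a \<mu>. smooth_in c (\<lambda>x. \<Omega>m d a c x $ \<mu>)"
    and \<Omega>p: "\<And>d a \<mu>. smooth_in c (\<lambda>x. \<Omega>p d a c x $ \<mu>)"
    and q1: "\<And>a. smooth_in c (\<lambda>x. q1 x $ a)" and q2: "\<And>a. smooth_in c (\<lambda>x. q2 x $ a)"
    and r: "\<And>a. smooth_in c (\<lambda>x. r x $ a)" and p: "p \<in> fst c"
    and flat: "\<And>e. curvature \<Omega>m q1 q2 (Q_frame e) p = 0"
  shows "curvature \<Omega>p q1 q2 r p = 0"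
proof -
  let ?K = "curvature \<Omega>p q1 q2 r p"
  have "(frame_comps c E \<rho> p *v ?K) $ e = 0" for e
    using metric_dual_curvature[OF dual \<Omega>m \<Omega>p q1 q2 _ r p, of "Q_frame e"] flat[of e]
    by (simp add: Q_frame_def smooth_in_const inner_axis' )
  then have "matrix_inv (frame_comps c E \<rho> p) *v (frame_comps c E \<rho> p *v ?K) = 0"
    by (simp add: vec_eq_iff matrix_vector_mult_def)
  then show ?thesis
    by (simp add: matrix_vector_mul_assoc invertible_matrix_inv[OF invertible_frame_comps[OF p]])
qed

end

section \<open>Change of chart\<close>

lemma manifold_coordinate_chart:
  assumes "smooth_manifold X A" "c \<in> A"
  shows "coordinate_chart c"
proof
  have c: "openin X (fst c)" "open (snd c ` fst c)"
      "homeomorphic_map (subtopology X (fst c)) (top_of_set (snd c ` fst c)) (snd c)"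
    using assms by (auto simp: smooth_manifold_def is_chart_def)
  show "open (snd c ` fst c)" by (fact c(2))
  show "inj_on (snd c) (fst c)"
    using homeomorphic_imp_injective_map[OF c(3)] openin_subset[OF c(1)]
    by (simp add: Int_absorb1)
qed

text \<open>Openness makes the full derivatives at a point of the overlap insensitive to the two functions
  being compared elsewhere in their charts.\<close>

lemma open_overlap:
  assumes "smooth_manifold X A" "c \<in> A" "c' \<in> A"
  shows "open (snd c ` (fst c \<inter> fst c'))"
proof -
  have c: "openin X (fst c)" "openin X (fst c')" "open (snd c ` fst c)"
      "homeomorphic_map (subtopology X (fst c)) (top_of_set (snd c ` fst c)) (snd c)"
    using assms by (auto simp: smooth_manifold_def is_chart_def)
  have "openin (subtopology X (fst c)) (fst c \<inter> fst c')"
    using c(2) by (metis inf_commute openin_subtopology_Int)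
  then have "openin (top_of_set (snd c ` fst c)) (snd c ` (fst c \<inter> fst c'))"
    using homeomorphic_map_openness_eq[OF c(4)] by blast
  then show ?thesis
    using c(3) by (metis openin_open_trans)
qed

text \<open>The chain rule for the transition map. The two functions are compared on the overlap only,
  because components in a chart have a meaning only on its domain.\<close>

lemma chart_pd_change_chart:
  fixes A :: "('m, 'n::finite) chart set"
  assumes X: "smooth_manifold X A" "c \<in> A" "c' \<in> A" and p: "p \<in> fst c \<inter> fst c'"
    and f: "smooth_in c' f" and eq: "\<And>x. x \<in> fst c \<inter> fst c' \<Longrightarrow> g x = f x"
  shows "chart_pd c \<nu> g p = (\<Sum>\<kappa>\<in>UNIV. chart_pd c' \<kappa> f p * jac c c' p \<kappa> \<nu>)"
proof -
  interpret c: coordinate_chart c using manifold_coordinate_chart X by blast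
  interpret c': coordinate_chart c' using manifold_coordinate_chart X by blast
  define \<tau> where "\<tau> = snd c' \<circ> inv_into (fst c) (snd c)"
  define F where "F = f \<circ> inv_into (fst c') (snd c')"
  let ?x = "snd c p" and ?W = "snd c ` (fst c \<inter> fst c')"
  have \<tau>x: "\<tau> ?x = snd c' p" using p by (simp add: \<tau>_def)
  have "smooth_on ?W \<tau>" using X by (auto simp: smooth_manifold_def \<tau>_def)
  then have \<tau>: "\<tau> differentiable at ?x" using p by (auto intro: smooth_on_differentiable)
  have F: "F differentiable at (\<tau> ?x)"
    unfolding \<tau>x using f p by (auto simp: F_def smooth_in_def intro: smooth_on_differentiable)
  have DF: "linear (frechet_derivative F (at (\<tau> ?x)))"
    using F by (rule linear_frechet_derivative)
  have "frechet_derivative (F \<circ> \<tau>) (at ?x)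
      = frechet_derivative (g \<circ> inv_into (fst c) (snd c)) (at ?x)"
  proof (rule frechet_derivative_transform_within_open[where X = ?W])
    show "F \<circ> \<tau> differentiable at ?x" using F \<tau> by (intro differentiable_chain_at)
    show "open ?W" by (rule open_overlap[OF X])
  qed (use p in \<open>auto simp: F_def \<tau>_def eq\<close>)
  then have "chart_pd c \<nu> g p = frechet_derivative (F \<circ> \<tau>) (at ?x) (axis \<nu> 1)"
    by (simp add: chart_pd_def)
  also have "\<dots> = frechet_derivative F (at (snd c' p)) (frechet_derivative \<tau> (at ?x) (axis \<nu> 1))"
    by (simp add: frechet_derivative_compose[OF \<tau> F] \<tau>x)
  also have "frechet_derivative \<tau> (at ?x) (axis \<nu> 1) = (\<Sum>\<kappa>\<in>UNIV. jac c c' p \<kappa> \<nu> *\<^sub>R axis \<kappa> 1)"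
  proof -
    have "((\<lambda>y. \<tau> y $ \<kappa>) has_derivative (\<lambda>h. frechet_derivative \<tau> (at ?x) h $ \<kappa>)) (at ?x)" for \<kappa>
      using \<tau> unfolding frechet_derivative_works by (rule bounded_linear.has_derivative[OF bounded_linear_vec_nth])
    from frechet_derivative_at[OF this, symmetric]
    have "jac c c' p \<kappa> \<nu> = frechet_derivative \<tau> (at ?x) (axis \<nu> 1) $ \<kappa>" for \<kappa>
      by (simp add: jac_def chart_pd_def \<tau>_def o_def)
    then show ?thesis
      by (simp add: vec_eq_iff axis_def if_distrib[of "\<lambda>x. _ * x"] cong: if_cong)
  qed
  also have "frechet_derivative F (at (snd c' p)) \<dots>
      = (\<Sum>\<kappa>\<in>UNIV. chart_pd c' \<kappa> f p * jac c c' p \<kappa> \<nu>)"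
    using DF unfolding \<tau>x
    by (simp add: linear_sum linear_cmul chart_pd_def F_def mult.commute)
  finally show ?thesis .
qed

lemma vderiv_change_chart:
  fixes A :: "('m, 'n::finite) chart set"
  assumes X: "smooth_manifold X A" "c \<in> A" "c' \<in> A" and p: "p \<in> fst c \<inter> fst c'"
    and v: "vector_field A v"
    and f: "smooth_in c' f" and eq: "\<And>x. x \<in> fst c \<inter> fst c' \<Longrightarrow> g x = f x"
  shows "vderiv c v g p = vderiv c' v f p"
proof -
  have "vderiv c v g p
      = (\<Sum>\<nu>\<in>UNIV. \<Sum>\<kappa>\<in>UNIV. jac c c' p \<kappa> \<nu> * v c p $ \<nu> * chart_pd c' \<kappa> f p)"
    using chart_pd_change_chart[OF X p f eq] by (simp add: vderiv_def sum_distrib_left mult_ac)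
  also have "\<dots> = (\<Sum>\<kappa>\<in>UNIV. \<Sum>\<nu>\<in>UNIV. jac c c' p \<kappa> \<nu> * v c p $ \<nu> * chart_pd c' \<kappa> f p)"
    by (rule sum.swap)
  also have "\<dots> = vderiv c' v f p"
  proof -
    have "v c' p $ \<kappa> = (\<Sum>\<nu>\<in>UNIV. jac c c' p \<kappa> \<nu> * v c p $ \<nu>)" for \<kappa>
      using v X p unfolding vector_field_def by blast
    then show ?thesis by (simp add: vderiv_def sum_distrib_right)
  qed
  finally show ?thesis .
qed

definition jac_matrix :: "('m, 'n::finite) chart \<Rightarrow> ('m, 'n) chart \<Rightarrow> 'm \<Rightarrow> real ^ 'n ^ 'n"
  where "jac_matrix c c' p = (\<chi> \<kappa> \<mu>. jac c c' p \<kappa> \<mu>)"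

lemma anchor_matrix_change_chart:
  assumes "\<And>a. vector_field A (\<rho> a)" "c \<in> A" "c' \<in> A" "p \<in> fst c \<inter> fst c'"
  shows "anchor_matrix \<rho> c' p = jac_matrix c c' p ** anchor_matrix \<rho> c p"
proof -
  have "\<rho> a c' p $ \<mu> = (\<Sum>\<nu>\<in>UNIV. jac c c' p \<mu> \<nu> * \<rho> a c p $ \<nu>)" for a \<mu>
    using assms unfolding vector_field_def by blast
  then show ?thesis
    by (simp add: anchor_matrix_def jac_matrix_def matrix_matrix_mult_def vec_eq_iff)
qed

lemma covariant2_change_chart:
  assumes "covariant2 A E" "c \<in> A" "c' \<in> A" "p \<in> fst c \<inter> fst c'"
  shows "E c p = transpose (jac_matrix c c' p) ** E c' p ** jac_matrix c c' p"
proof -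
  have "E c p $ \<mu> $ \<nu> = (\<Sum>\<kappa>\<in>UNIV. \<Sum>\<tau>\<in>UNIV. E c' p $ \<kappa> $ \<tau> * jac c c' p \<kappa> \<mu> * jac c c' p \<tau> \<nu>)" for \<mu> \<nu>
    using assms unfolding covariant2_def by blast
  moreover have "(\<Sum>\<kappa>\<in>UNIV. \<Sum>\<tau>\<in>UNIV. E c' p $ \<kappa> $ \<tau> * jac c c' p \<kappa> \<mu> * jac c c' p \<tau> \<nu>)
      = (\<Sum>\<tau>\<in>UNIV. (\<Sum>\<kappa>\<in>UNIV. jac c c' p \<kappa> \<mu> * E c' p $ \<kappa> $ \<tau>) * jac c c' p \<tau> \<nu>)" for \<mu> \<nu>
    unfolding sum_distrib_right by (subst sum.swap) (simp add: mult_ac)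
  ultimately show ?thesis
    by (simp add: jac_matrix_def matrix_matrix_mult_def transpose_def vec_eq_iff)
qed

lemma coeff_matrix_change_chart:
  assumes "TM_connection A \<Omega>" "c \<in> A" "c' \<in> A" "p \<in> fst c \<inter> fst c'"
  shows "coeff_matrix \<Omega> a c p = coeff_matrix \<Omega> a c' p ** jac_matrix c c' p"
proof -
  have "\<Omega> b a c p $ \<mu> = (\<Sum>\<kappa>\<in>UNIV. \<Omega> b a c' p $ \<kappa> * jac c c' p \<kappa> \<mu>)" for b \<mu>
    using assms unfolding TM_connection_def one_form_def by blast
  then show ?thesis
    by (simp add: coeff_matrix_def jac_matrix_def matrix_matrix_mult_def vec_eq_iff)
qed

section \<open>The metric dual of a connection\<close>

text \<open>The solution of the duality equation \<open>metric_dual\<close> for the adjoint matrix of the second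
  connection.\<close>

definition dual_adjoint_matrix ::
    "('m, 'n::finite) tensor2_comps \<Rightarrow> ('n \<Rightarrow> ('m, 'n) vector_comps) \<Rightarrow> ('n \<Rightarrow> 'n \<Rightarrow> 'n \<Rightarrow> 'm \<Rightarrow> real) \<Rightarrow>
     ('m, 'n) TM_conn \<Rightarrow> 'n \<Rightarrow> ('m, 'n) chart \<Rightarrow> 'm \<Rightarrow> real ^ 'n ^ 'n"
  where "dual_adjoint_matrix E \<rho> C \<Omega> a c p = matrix_inv (frame_comps c E \<rho> p) **
    (mderiv c (\<rho> a) (frame_comps c E \<rho>) p
      - transpose (adjoint_matrix c \<rho> C \<Omega> a p) ** frame_comps c E \<rho> p)"

text \<open>The \<open>TM\<close>-connection with the adjoint matrix just found: remove the structure functions and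
  convert the remaining frame index into a form index by the dual coframe, whose components are
  the rows of the inverse anchor matrix.\<close>

definition dual_connection ::
    "('m, 'n::finite) tensor2_comps \<Rightarrow> ('n \<Rightarrow> ('m, 'n) vector_comps) \<Rightarrow> ('n \<Rightarrow> 'n \<Rightarrow> 'n \<Rightarrow> 'm \<Rightarrow> real) \<Rightarrow>
     ('m, 'n) TM_conn \<Rightarrow> ('m, 'n) TM_conn"
  where "dual_connection E \<rho> C \<Omega> = (\<lambda>b a c p.
    ((dual_adjoint_matrix E \<rho> C \<Omega> a c p - structure_matrix C a p) ** matrix_inv (anchor_matrix \<rho> c p)) $ b)"

lemma coeff_matrix_dual_connection:
  "coeff_matrix (dual_connection E \<rho> C \<Omega>) a c p
    = (dual_adjoint_matrix E \<rho> C \<Omega> a c p - structure_matrix C a p) ** matrix_inv (anchor_matrix \<rho> c p)"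
  by (simp add: coeff_matrix_def dual_connection_def vec_eq_iff)

context chart_frame
begin

lemma adjoint_matrix_dual_connection:
  assumes "p \<in> fst c"
  shows "adjoint_matrix c \<rho> C (dual_connection E \<rho> C \<Omega>) a p = dual_adjoint_matrix E \<rho> C \<Omega> a c p"
  by (simp add: adjoint_matrix_eq coeff_matrix_dual_connection matrix_mul_assoc[symmetric]
      invertible_matrix_inv[OF invertible_frame[OF assms]])

lemma metric_dual_dual_connection: "metric_dual \<Omega> (dual_connection E \<rho> C \<Omega>)"
  by (simp add: metric_dual_def adjoint_matrix_dual_connection dual_adjoint_matrix_def matrix_mul_assoc
      invertible_matrix_inv[OF invertible_frame_comps])

lemma smooth_coeff_matrix_dual_connection:
  assumes "\<And>d a \<mu>. smooth_in c (\<lambda>x. \<Omega> d a c x $ \<mu>)"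
  shows "smooth_matrix c (coeff_matrix (dual_connection E \<rho> C \<Omega>) a c)"
proof -
  have "smooth_matrix c (coeff_matrix \<Omega> a c)"
    using assms by (simp add: smooth_matrix_def coeff_matrix_def)
  then show ?thesis
    unfolding coeff_matrix_dual_connection[abs_def] dual_adjoint_matrix_def adjoint_matrix_eq
    by (intro smooth_matrix_mult smooth_matrix_diff smooth_matrix_add smooth_matrix_inv
        smooth_matrix_transpose smooth_matrix_mderiv smooth_frame smooth_frame_comps
        smooth_anchor_matrix smooth_structure_matrix invertible_frame_comps invertible_frame)
qed

lemma dual_adjoint_matrix_entry:
  "dual_adjoint_matrix E \<rho> C \<Omega> a c p $ b $ k =
     (\<Sum>d\<in>UNIV. matrix_inv (frame_comps c E \<rho> p) $ b $ d
        * (\<Sum>\<mu>\<in>UNIV. \<rho> a c p $ \<mu> * chart_pd c \<mu> (\<lambda>x. frame_comps c E \<rho> x $ d $ k) p))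
   - (\<Sum>d\<in>UNIV. \<Sum>e\<in>UNIV. frame_comps c E \<rho> p $ d $ k
        * adjoint_coeff c \<rho> C \<Omega> d a e p * matrix_inv (frame_comps c E \<rho> p) $ b $ e)"
proof -
  let ?G = "frame_comps c E \<rho> p"
  have "(matrix_inv ?G ** (transpose (adjoint_matrix c \<rho> C \<Omega> a p) ** ?G)) $ b $ k
      = (\<Sum>e\<in>UNIV. \<Sum>d\<in>UNIV. ?G $ d $ k * adjoint_coeff c \<rho> C \<Omega> d a e p * matrix_inv ?G $ b $ e)"
    by (simp add: matrix_matrix_mult_def transpose_def adjoint_matrix_def sum_distrib_left mult_ac)
  also have "\<dots> = (\<Sum>d\<in>UNIV. \<Sum>e\<in>UNIV. ?G $ d $ k * adjoint_coeff c \<rho> C \<Omega> d a e p * matrix_inv ?G $ b $ e)"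
    by (rule sum.swap)
  finally show ?thesis
    unfolding dual_adjoint_matrix_def matrix_diff_ldistrib
    by (simp, simp add: matrix_matrix_mult_def mderiv_def vderiv_def)
qed

end

locale manifold_frame =
  fixes X :: "'m topology" and A :: "('m, 'n::finite) chart set" and E :: "('m, 'n) tensor2_comps"
    and \<rho> :: "'n \<Rightarrow> ('m, 'n) vector_comps" and C :: "'n \<Rightarrow> 'n \<Rightarrow> 'n \<Rightarrow> 'm \<Rightarrow> real"
  assumes manifold: "smooth_manifold X A"
    and metric: "covariant2 A E"
    and metric_invertible: "\<forall>c\<in>A. \<forall>p\<in>fst c. invertible (E c p)"
    and frame: "\<forall>a. vector_field A (\<rho> a)"
    and structure_smooth: "\<forall>d a b. smooth_function A (C d a b)"
    and involutive: "\<forall>a b. \<forall>c\<in>A. \<forall>p\<in>fst c.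
           lie_bracket c (\<rho> a) (\<rho> b) p = (\<Sum>d\<in>UNIV. C d a b p *\<^sub>R \<rho> d c p)"
    and frame_invertible: "\<forall>c\<in>A. \<forall>p\<in>fst c. invertible (anchor_matrix \<rho> c p)"
begin

lemma chart_frame: "c \<in> A \<Longrightarrow> chart_frame c \<rho> C E"
  using manifold_coordinate_chart[OF manifold] metric metric_invertible frame structure_smooth
    involutive frame_invertible
  by (auto simp: chart_frame_def chart_frame_axioms_def covariant2_def vector_field_def smooth_function_def)

lemma frame_comps_chart_independent:
  assumes "c \<in> A" "c' \<in> A" "p \<in> fst c \<inter> fst c'"
  shows "frame_comps c E \<rho> p = frame_comps c' E \<rho> p"
  using anchor_matrix_change_chart[of A \<rho>, OF _ assms] frame covariant2_change_chart[OF metric assms]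
  by (simp add: frame_comps_matrix matrix_transpose_mul matrix_mul_assoc)

text \<open>Everything in the formula is a scalar: Gram matrix and adjoint matrix are full contractions of
  tensors with frame fields, and a vector field acts on functions in the same way in every chart.\<close>

lemma dual_adjoint_matrix_chart_independent:
  assumes \<Omega>: "TM_connection A \<Omega>" and c: "c \<in> A" "c' \<in> A" and p: "p \<in> fst c \<inter> fst c'"
  shows "dual_adjoint_matrix E \<rho> C \<Omega> a c p = dual_adjoint_matrix E \<rho> C \<Omega> a c' p"
proof -
  interpret c: chart_frame c \<rho> C E using chart_frame c by blast
  interpret c': chart_frame c' \<rho> C E using chart_frame c by blast
  note G = frame_comps_chart_independent[OF c]
  have "vderiv c (\<rho> a) (\<lambda>x. frame_comps c E \<rho> x $ i $ j) p
      = vderiv c' (\<rho> a) (\<lambda>x. frame_comps c' E \<rho> x $ i $ j) p" for i j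
    using frame c'.smooth_frame_comps G
    by (intro vderiv_change_chart[OF manifold c p]) (auto simp: smooth_matrix_def)
  then have "mderiv c (\<rho> a) (frame_comps c E \<rho>) p = mderiv c' (\<rho> a) (frame_comps c' E \<rho>) p"
    by (simp add: mderiv_def)
  moreover have "adjoint_matrix c \<rho> C \<Omega> a p = adjoint_matrix c' \<rho> C \<Omega> a p"
    using anchor_matrix_change_chart[of A \<rho>, OF _ c p] frame coeff_matrix_change_chart[OF \<Omega> c p]
    by (simp add: c.adjoint_matrix_eq c'.adjoint_matrix_eq matrix_mul_assoc)
  ultimately show ?thesis
    by (simp add: dual_adjoint_matrix_def G[OF p])
qed

text \<open>The coefficients in the frame are scalars, so the components transform as the dual coframe does.\<close>

lemma TM_connection_dual_connection:
  assumes \<Omega>: "TM_connection A \<Omega>"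
  shows "TM_connection A (dual_connection E \<rho> C \<Omega>)"
proof -
  let ?D = "dual_connection E \<rho> C \<Omega>"
  have "smooth_in c (\<lambda>x. ?D b a c x $ \<mu>)" if "c \<in> A" for c a b \<mu>
  proof -
    interpret chart_frame c \<rho> C E using chart_frame that .
    show ?thesis
      using smooth_coeff_matrix_dual_connection[of \<Omega> a] \<Omega> that
      by (simp add: TM_connection_def one_form_def smooth_matrix_def coeff_matrix_def)
  qed
  moreover have "coeff_matrix ?D a c p = coeff_matrix ?D a c' p ** jac_matrix c c' p"
    if c: "c \<in> A" "c' \<in> A" and p: "p \<in> fst c \<inter> fst c'" for c c' p a
  proof -
    let ?R = "anchor_matrix \<rho> c p" and ?R' = "anchor_matrix \<rho> c' p"
    have R: "invertible ?R" "invertible ?R'" using frame_invertible c p by auto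
    have "?R' = jac_matrix c c' p ** ?R"
      using anchor_matrix_change_chart[of A \<rho>, OF _ c p] frame by blast
    then have "matrix_inv ?R' ** jac_matrix c c' p = matrix_inv ?R"
      using invertible_matrix_inv[OF R(1)] invertible_matrix_inv[OF R(2)]
      by (metis matrix_mul_assoc matrix_mul_lid matrix_mul_rid)
    then show ?thesis
      by (simp add: coeff_matrix_dual_connection dual_adjoint_matrix_chart_independent[OF \<Omega> c p]
          matrix_mul_assoc[symmetric])
  qed
  ultimately show ?thesis
    by (simp add: TM_connection_def one_form_def coeff_matrix_def jac_matrix_def
        matrix_matrix_mult_def vec_eq_iff)
qed

lemma generalised_Killing_dual_connection:
  "generalised_Killing A E \<rho> (dual_connection E \<rho> C \<Omega>) \<Omega>"
proof -
  have "generalised_Killing {c} E \<rho> (dual_connection E \<rho> C \<Omega>) \<Omega>" if "c \<in> A" for c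
  proof -
    interpret chart_frame c \<rho> C E using chart_frame that .
    show ?thesis
      using metric_dual_dual_connection by (simp add: Killing_iff_metric_dual)
  qed
  then show ?thesis by (simp add: generalised_Killing_def)
qed

text \<open>Flatness of the given connection is applied to the frame sections, which are constant and hence
  smooth on the whole manifold.\<close>

lemma flat_dual_connection:
  assumes \<Omega>: "TM_connection A \<Omega>"
    and flat: "flat_Q_connection A \<rho> C (\<lambda>c. adjoint_nabla c \<rho> C \<Omega>)"
  shows "flat_Q_connection A \<rho> C (\<lambda>c. adjoint_nabla c \<rho> C (dual_connection E \<rho> C \<Omega>))"
  unfolding flat_Q_connection_def
proof (intro allI impI ballI)
  fix q1 q2 r c p
  assume s: "smooth_section A q1" "smooth_section A q2" "smooth_section A r" and c: "c \<in> A"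
    and p: "p \<in> fst c"
  interpret chart_frame c \<rho> C E using chart_frame c .
  have "smooth_section A (Q_frame e)" for e
    using manifold_coordinate_chart[OF manifold]
    by (auto simp: smooth_section_def smooth_function_def Q_frame_def intro: coordinate_chart.smooth_in_const)
  then have "curvature \<Omega> q1 q2 (Q_frame e) p = 0" for e
    using flat s c p by (simp add: flat_Q_connection_def)
  moreover have "smooth_in c (\<lambda>x. \<Omega>' d a c x $ \<mu>)" if "TM_connection A \<Omega>'" for \<Omega>' d a \<mu>
    using that c by (simp add: TM_connection_def one_form_def)
  ultimately show "curvature (dual_connection E \<rho> C \<Omega>) q1 q2 r p = 0"
    using s c p \<Omega> TM_connection_dual_connection[OF \<Omega>]
    by (intro flat_metric_dual[OF metric_dual_dual_connection])
      (auto simp: smooth_section_def smooth_function_def)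
qed

end

theorem corollary4p6:
  fixes X :: "'m topology"
    and A :: "('m, 'n::finite) chart set"
    and E :: "('m, 'n) tensor2_comps"
    and \<rho> :: "'n \<Rightarrow> ('m, 'n) vector_comps"
    and C :: "'n \<Rightarrow> 'n \<Rightarrow> 'n \<Rightarrow> 'm \<Rightarrow> real"
  assumes "smooth_manifold X A"
    and "covariant2 A E"
    and "\<forall>c\<in>A. \<forall>p\<in>fst c. invertible (E c p)"
    and "\<forall>a. vector_field A (\<rho> a)"
    and "\<forall>d a b. smooth_function A (C d a b)"
    and "\<forall>a b. \<forall>c\<in>A. \<forall>p\<in>fst c.
           lie_bracket c (\<rho> a) (\<rho> b) p = (\<Sum>d\<in>UNIV. C d a b p *\<^sub>R \<rho> d c p)"
    and "\<forall>c\<in>A. \<forall>p\<in>fst c. invertible (anchor_matrix \<rho> c p)"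
  shows "(\<exists>\<Omega>p \<Omega>m. TM_connection A \<Omega>p \<and> TM_connection A \<Omega>m \<and> generalised_Killing A E \<rho> \<Omega>p \<Omega>m)
    \<and> (\<forall>\<Omega>m. TM_connection A \<Omega>m \<longrightarrow>
         flat_Q_connection A \<rho> C (\<lambda>c. adjoint_nabla c \<rho> C \<Omega>m) \<longrightarrow>
         (\<exists>\<Omega>p. TM_connection A \<Omega>p \<and> generalised_Killing A E \<rho> \<Omega>p \<Omega>m \<and>
            (\<forall>c\<in>A. \<forall>p\<in>fst c. \<forall>b a k.
               adjoint_coeff c \<rho> C \<Omega>p b a k p =
                 (\<Sum>d\<in>UNIV. matrix_inv (frame_comps c E \<rho> p) $ b $ d
                    * (\<Sum>\<mu>\<in>UNIV. \<rho> a c p $ \<mu> * chart_pd c \<mu> (\<lambda>x. frame_comps c E \<rho> x $ d $ k) p))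
               - (\<Sum>d\<in>UNIV. \<Sum>e\<in>UNIV. frame_comps c E \<rho> p $ d $ k
                    * adjoint_coeff c \<rho> C \<Omega>m d a e p * matrix_inv (frame_comps c E \<rho> p) $ b $ e)) \<and>
            flat_Q_connection A \<rho> C (\<lambda>c. adjoint_nabla c \<rho> C \<Omega>p)))"
proof -
  interpret manifold_frame X A E \<rho> C
    using assms by unfold_locales
  have "TM_connection A (\<lambda>b a c p. 0)"
    using manifold_coordinate_chart[OF manifold]
    by (auto simp: TM_connection_def one_form_def intro: coordinate_chart.smooth_in_const)
  then have "\<exists>\<Omega>p \<Omega>m. TM_connection A \<Omega>p \<and> TM_connection A \<Omega>m \<and> generalised_Killing A E \<rho> \<Omega>p \<Omega>m"
    using TM_connection_dual_connection generalised_Killing_dual_connection by blast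
  moreover have "\<exists>\<Omega>p. TM_connection A \<Omega>p \<and> generalised_Killing A E \<rho> \<Omega>p \<Omega>m \<and>
      (\<forall>c\<in>A. \<forall>p\<in>fst c. \<forall>b a k.
         adjoint_coeff c \<rho> C \<Omega>p b a k p =
           (\<Sum>d\<in>UNIV. matrix_inv (frame_comps c E \<rho> p) $ b $ d
              * (\<Sum>\<mu>\<in>UNIV. \<rho> a c p $ \<mu> * chart_pd c \<mu> (\<lambda>x. frame_comps c E \<rho> x $ d $ k) p))
         - (\<Sum>d\<in>UNIV. \<Sum>e\<in>UNIV. frame_comps c E \<rho> p $ d $ k
              * adjoint_coeff c \<rho> C \<Omega>m d a e p * matrix_inv (frame_comps c E \<rho> p) $ b $ e)) \<and>
      flat_Q_connection A \<rho> C (\<lambda>c. adjoint_nabla c \<rho> C \<Omega>p)"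
    if \<Omega>m: "TM_connection A \<Omega>m" "flat_Q_connection A \<rho> C (\<lambda>c. adjoint_nabla c \<rho> C \<Omega>m)" for \<Omega>m
  proof (intro exI[of _ "dual_connection E \<rho> C \<Omega>m"] conjI ballI allI)
    fix c p b a k assume c: "c \<in> A" "p \<in> fst c"
    interpret chart_frame c \<rho> C E using chart_frame c(1) .
    have "adjoint_coeff c \<rho> C (dual_connection E \<rho> C \<Omega>m) b a k p = dual_adjoint_matrix E \<rho> C \<Omega>m a c p $ b $ k"
      using adjoint_matrix_dual_connection[OF c(2), of \<Omega>m a, symmetric] by (simp add: adjoint_matrix_def)
    then show "adjoint_coeff c \<rho> C (dual_connection E \<rho> C \<Omega>m) b a k p =
           (\<Sum>d\<in>UNIV. matrix_inv (frame_comps c E \<rho> p) $ b $ d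
              * (\<Sum>\<mu>\<in>UNIV. \<rho> a c p $ \<mu> * chart_pd c \<mu> (\<lambda>x. frame_comps c E \<rho> x $ d $ k) p))
         - (\<Sum>d\<in>UNIV. \<Sum>e\<in>UNIV. frame_comps c E \<rho> p $ d $ k
              * adjoint_coeff c \<rho> C \<Omega>m d a e p * matrix_inv (frame_comps c E \<rho> p) $ b $ e)"
      by (simp only: dual_adjoint_matrix_entry)
  qed (use \<Omega>m TM_connection_dual_connection generalised_Killing_dual_connection flat_dual_connection in blast)+
  ultimately show ?thesis by blast
qed

end
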